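(* Let $B$ be an infinite Blaschke product with zeros $\{a_n\}$. If $B' \in A_{\alpha}^p$, where $\alpha > -1$ and $\frac{3}{2} + \alpha < p < 2 + \alpha$, then \[ \sum_n (1-|a_n|)^{\frac{2-p+\alpha}{p - 1 - \alpha}} < \infty. \]
   Context: $U$ denotes the open unit disc in $\mathbb{C}$. For $0<p<\infty$ and $\alpha>-1$, $A_\alpha^p$ is the set of all functions $f$ analytic in $U$ with $\|f\|_{A_\alpha^p} = \left\{\frac{1}{\pi}\iint_U |f(z)|^p (1-|z|)^\alpha\, dA(z)\right\}^{1/p} < \infty$, where $dA$ is Lebesgue area measure. If $\{a_n\}_{n\ge 1}$ is a sequence of complex numbers with $0<|a_n|<1$ for all $n$ and $\sum_n (1-|a_n|)<\infty$, the Blaschke product with zeros $\{a_n\}$ is the analytic function on $U$ given by $B(z) = \prod_{n=1}^\infty \frac{\bar a_n}{|a_n|}\frac{a_n - z}{1-\bar a_n z}$. *)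

theory Defs
  imports "HOL-Analysis.Analysis"
begin

abbreviation unit_disc :: "complex set" where
  "unit_disc \<equiv> ball 0 1"

(* The norm takes the value \<infinity> when the area integral diverges. *)
definition bergman_norm :: "real \<Rightarrow> real \<Rightarrow> (complex \<Rightarrow> complex) \<Rightarrow> ennreal" where
  "bergman_norm p \<alpha> f =
     (let J = \<integral>\<^sup>+z\<in>unit_disc. ennreal (cmod (f z) powr p * (1 - cmod z) powr \<alpha>) \<partial>lborel
      in if J = \<infinity> then \<infinity> else ennreal ((1 / pi * enn2real J) powr (1 / p)))"

(* Only meant for p > 0 and \<alpha> > -1. Functions are total on the type complex, but only
   their values on the disc matter. *)
definition bergman_space :: "real \<Rightarrow> real \<Rightarrow> (complex \<Rightarrow> complex) set" where
  "bergman_space p \<alpha> = {f. f analytic_on unit_disc \<and> bergman_norm p \<alpha> f < \<infinity>}"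

(* Zeros are repeated according to multiplicity, so a need not be injective. *)
definition blaschke_sequence :: "(nat \<Rightarrow> complex) \<Rightarrow> bool" where
  "blaschke_sequence a \<longleftrightarrow>
     (\<forall>n. 0 < cmod (a n) \<and> cmod (a n) < 1) \<and> summable (\<lambda>n. 1 - cmod (a n))"

(* The library's infinite product admits finitely many vanishing factors, so this has the
   intended value 0 at the points a n. *)
definition blaschke_product :: "(nat \<Rightarrow> complex) \<Rightarrow> complex \<Rightarrow> complex" where
  "blaschke_product a z =
     (\<Prod>n. cnj (a n) / of_real (cmod (a n)) * ((a n - z) / (1 - cnj (a n) * z)))"

end

theory Submission
  imports Defs "HOL-Complex_Analysis.Cauchy_Integral_Formula"
begin

text \<open>
  Put \<open>s = p - 1 - \<alpha>\<close>, a number in \<open>(0, 1)\<close>, let \<open>d\<^sub>n = 1 - |a\<^sub>n|\<close>, and write \<open>t = 1 - |z|\<close> for the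
  height of a point \<open>z\<close> above the circle. If \<open>b\<^sub>n\<close> are the factors of \<open>B\<close>, let
  \<open>g\<^sub>n = 1 - |b\<^sub>n|\<^sup>2\<close> and \<open>G = \<Sum>\<^sub>n g\<^sub>n\<close>; multiplying out gives \<open>1 - G \<le> |B|\<^sup>2 \<le> exp (-G)\<close>.
  The proof compares two estimates for a stopping time \<open>\<tau>\<close>: on the radius with angle \<open>\<theta>\<close> let
  \<open>\<tau>(\<theta>)\<close> be the least height of the form \<open>2\<^sup>-\<^sup>k\<close>, \<open>k \<ge> 1\<close>, at which \<open>G \<ge> 1/18\<close>, and \<open>1\<close> if there
  is none.

  \<^bold>\<open>The Bergman norm bounds \<open>\<integral> \<tau>\<^sup>-\<^sup>s\<close>.\<close> The means of \<open>G\<close> over circles tend to \<open>0\<close> at the boundary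
  because the Poisson kernel has mean \<open>1\<close>; hence on almost every radius \<open>|B|\<close> comes arbitrarily
  close to \<open>1\<close> (\<open>AE_liminf_suminf_defect_eq_0\<close>). At height \<open>\<tau>\<close> it is bounded away from \<open>1\<close>, so
  \<open>|B'|\<close> has integral at least some \<open>\<delta> > 0\<close> over the part of the radius below that height. With the
  Cauchy estimate \<open>|B'| \<le> 2/t\<close> this forces \<open>\<integral> |B'|\<^sup>p t\<^sup>\<alpha> dt \<ge> c \<tau>\<^sup>-\<^sup>s\<close> along the radius
  (\<open>energy_ge_of_total_variation_ge\<close>). The same bound holds at every dyadic height with \<open>G \<ge> 1/18\<close>, so
  there are finitely many of them where the left-hand side is finite, and \<open>\<tau>\<close> is well defined almost
  everywhere. Integrate over \<open>\<theta>\<close> and use polar coordinates.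

  \<^bold>\<open>The integral of \<open>\<tau>\<^sup>-\<^sup>s\<close> bounds the sum over the zeros.\<close> At height \<open>\<tau>/2\<close> the sum \<open>G\<close> is small,
  so \<open>\<Sum>\<^sub>n \<integral> \<tau>\<^sup>-\<^sup>s g\<^sub>n \<le> \<integral> \<tau>\<^sup>-\<^sup>s\<close>, where \<open>g\<^sub>n\<close> is taken at height \<open>\<tau>/2\<close>. On an arc \<open>I\<^sub>n\<close> of length \<open>d\<^sub>n\<close> next to \<open>a\<^sub>n\<close> the
  single term \<open>g\<^sub>n\<close> already exceeds \<open>1/18\<close> at a dyadic height \<open>\<le> d\<^sub>n\<close>, so \<open>\<tau> \<le> d\<^sub>n\<close> there, and then
  \<open>g\<^sub>n \<ge> \<tau> / (18 d\<^sub>n)\<close> at height \<open>\<tau>/2\<close>. Thus \<open>\<Sum>\<^sub>n d\<^sub>n\<^sup>-\<^sup>1 \<integral> \<tau>\<^sup>1\<^sup>-\<^sup>s\<close>, with the integrals over the arcs \<open>I\<^sub>n\<close>, converges.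
  Finally \<open>\<tau>\<close> cannot be too small on most of \<open>I\<^sub>n\<close>, again because \<open>\<integral> \<tau>\<^sup>-\<^sup>s \<le> K\<close>: it is of order at least
  \<open>(d\<^sub>n / K)\<close> to the power \<open>1/s\<close>, and the \<open>n\<close>-th summand is at least a constant times \<open>d\<^sub>n\<close> to the power
  \<open>(1 - s) / s\<close> (\<open>summable_of_stopping_time\<close>).
\<close>

section \<open>Polar coordinates in the plane\<close>

lemma lborel_complex_eq_distr:
  "(lborel :: complex measure) = distr (lborel \<Otimes>\<^sub>M lborel) borel (\<lambda>(x, y). Complex x y)"
proof (rule lborel_eqI)
  have [measurable]: "(\<lambda>(x, y). Complex x y) \<in> borel_measurable (lborel \<Otimes>\<^sub>M lborel)"
    by (simp add: Complex_eq case_prod_unfold)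
  fix l u :: complex
  assume lu: "\<And>b. b \<in> Basis \<Longrightarrow> l \<bullet> b \<le> u \<bullet> b"
  have "emeasure (distr (lborel \<Otimes>\<^sub>M lborel) borel (\<lambda>(x, y). Complex x y)) (box l u)
      = emeasure (lborel \<Otimes>\<^sub>M lborel) ({Re l<..<Re u} \<times> {Im l<..<Im u})"
    by (subst emeasure_distr)
      (auto intro!: arg_cong[where f = "emeasure _"] simp: box_def Basis_complex_def space_pair_measure)
  also have "\<dots> = (\<Prod>b\<in>Basis. (u - l) \<bullet> b)"
    using lu[of 1] lu[of \<i>]
    by (subst lborel.emeasure_pair_measure_Times) (auto simp: Basis_complex_def ennreal_mult)
  finally show "emeasure (distr (lborel \<Otimes>\<^sub>M lborel) borel (\<lambda>(x, y). Complex x y)) (box l u)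
      = (\<Prod>b\<in>Basis. (u - l) \<bullet> b)" .
qed simp

lemma borel_measurable_Complex [measurable]:
  assumes [measurable]: "f \<in> borel_measurable M" "g \<in> borel_measurable M"
  shows "(\<lambda>x. Complex (f x) (g x)) \<in> borel_measurable M"
  by (simp add: Complex_eq)

lemma nn_integral_complex:
  fixes F :: "complex \<Rightarrow> ennreal"
  assumes [measurable]: "F \<in> borel_measurable borel"
  shows "(\<integral>\<^sup>+z. F z \<partial>lborel) = (\<integral>\<^sup>+x. \<integral>\<^sup>+y. F (Complex x y) \<partial>lborel \<partial>lborel)"
  by (subst lborel_complex_eq_distr)
    (simp add: nn_integral_distr case_prod_unfold lborel.nn_integral_fst[symmetric])

lemma nn_integral_mult_ii:
  fixes F :: "complex \<Rightarrow> ennreal"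
  assumes [measurable]: "F \<in> borel_measurable borel"
  shows "(\<integral>\<^sup>+z. F (\<i> * z) \<partial>lborel) = (\<integral>\<^sup>+z. F z \<partial>lborel)"
proof -
  have "(\<integral>\<^sup>+z. F (\<i> * z) \<partial>lborel) = (\<integral>\<^sup>+x. \<integral>\<^sup>+y. F (Complex (- y) x) \<partial>lborel \<partial>lborel)"
    by (subst nn_integral_complex) (simp_all add: complex_eq_iff Complex_eq algebra_simps)
  also have "\<dots> = (\<integral>\<^sup>+x. \<integral>\<^sup>+y. F (Complex y x) \<partial>lborel \<partial>lborel)"
    by (subst (2) nn_integral_real_affine[where c = "-1" and t = 0]) simp_all
  also have "\<dots> = (\<integral>\<^sup>+y. \<integral>\<^sup>+x. F (Complex y x) \<partial>lborel \<partial>lborel)"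
    by (rule lborel_pair.Fubini') simp
  also have "\<dots> = (\<integral>\<^sup>+z. F z \<partial>lborel)"
    by (simp add: nn_integral_complex)
  finally show ?thesis .
qed

lemma nn_integral_mult_ii_power:
  fixes F :: "complex \<Rightarrow> ennreal"
  assumes [measurable]: "F \<in> borel_measurable borel"
  shows "(\<integral>\<^sup>+z. F (\<i> ^ k * z) \<partial>lborel) = (\<integral>\<^sup>+z. F z \<partial>lborel)"
proof (induction k)
  case (Suc k)
  show ?case
    using nn_integral_mult_ii[of "\<lambda>z. F (\<i> ^ k * z)"] Suc by (simp add: mult_ac)
qed simp

text \<open>
  Polar coordinates in a sector come from two substitutions in one variable each: for
  fixed \<open>x > 0\<close> put \<open>y = x tan \<theta>\<close>, exchange the integrals, and for fixed \<open>\<theta>\<close> put \<open>x = r cos \<theta>\<close>. The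
  two Jacobians \<open>x / cos\<^sup>2 \<theta>\<close> and \<open>cos \<theta>\<close> combine to \<open>r\<close>.
\<close>
lemma polar_sector_le:
  fixes f :: "complex \<Rightarrow> real"
  assumes [measurable]: "f \<in> borel_measurable borel"
  shows "(\<integral>\<^sup>+\<theta>\<in>{-pi/4..pi/4}. \<integral>\<^sup>+r\<in>{0<..}. ennreal (r * f (rcis r \<theta>)) \<partial>lborel \<partial>lborel)
       \<le> (\<integral>\<^sup>+z. ennreal (f z) \<partial>lborel)"
proof -
  define S where "S = {-pi/4..pi/4}"
  have cos_pos: "cos \<theta> > 0" if "\<theta> \<in> S" for \<theta>
    using that pi_gt_zero unfolding S_def atLeastAtMost_iff by (intro cos_gt_zero_pi) linarith+
  have [measurable]: "S \<in> sets borel" by (simp add: S_def)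
  have "(\<integral>\<^sup>+\<theta>\<in>S. \<integral>\<^sup>+r\<in>{0<..}. ennreal (r * f (rcis r \<theta>)) \<partial>lborel \<partial>lborel)
      = (\<integral>\<^sup>+\<theta>. (\<integral>\<^sup>+x. ennreal (f (Complex x (x * tan \<theta>)) * (x * inverse ((cos \<theta>)\<^sup>2)))
             * indicator S \<theta> * indicator {0<..} x \<partial>lborel) \<partial>lborel)"
  proof (intro nn_integral_cong)
    fix \<theta> :: real
    show "(\<integral>\<^sup>+r\<in>{0<..}. ennreal (r * f (rcis r \<theta>)) \<partial>lborel) * indicator S \<theta>
      = (\<integral>\<^sup>+x. ennreal (f (Complex x (x * tan \<theta>)) * (x * inverse ((cos \<theta>)\<^sup>2)))
             * indicator S \<theta> * indicator {0<..} x \<partial>lborel)"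
    proof (cases "\<theta> \<in> S")
      case True
      let ?c = "cos \<theta>"
      have c: "?c > 0" using cos_pos[OF True] .
      have "(\<integral>\<^sup>+x. ennreal (f (Complex x (x * tan \<theta>)) * (x * inverse ((cos \<theta>)\<^sup>2)))
             * indicator {0<..} x \<partial>lborel)
          = ?c * (\<integral>\<^sup>+r. ennreal (f (Complex (?c * r) (?c * r * tan \<theta>)) * (?c * r * inverse (?c\<^sup>2)))
             * indicator {0<..} (?c * r) \<partial>lborel)"
        using c by (subst nn_integral_real_affine[where c = ?c and t = 0]) (simp_all add: mult_ac)
      also have "\<dots> = (\<integral>\<^sup>+r. ennreal (r * f (rcis r \<theta>)) * indicator {0<..} r \<partial>lborel)"
      proof (subst nn_integral_cmult[symmetric], measurable, intro nn_integral_cong)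
        fix r :: real
        have "Complex (?c * r) (?c * r * tan \<theta>) = rcis r \<theta>"
          using c by (simp add: complex_eq_iff tan_def)
        moreover have "indicator {0<..} (?c * r) = (indicator {0<..} r :: ennreal)"
          using c by (simp add: indicator_def zero_less_mult_iff)
        moreover have "ennreal ?c * ennreal (f (rcis r \<theta>) * (?c * r * inverse (?c\<^sup>2))) = ennreal (r * f (rcis r \<theta>))"
        proof -
          have "?c * (f (rcis r \<theta>) * (?c * r * inverse (?c\<^sup>2))) = r * f (rcis r \<theta>)"
            using c by (simp add: field_simps power2_eq_square)
          then show ?thesis using c by (metis ennreal_mult' less_imp_le)
        qed
        ultimately show "ennreal ?c * (ennreal (f (Complex (?c * r) (?c * r * tan \<theta>)) * (?c * r * inverse (?c\<^sup>2)))
             * indicator {0<..} (?c * r)) = ennreal (r * f (rcis r \<theta>)) * indicator {0<..} r"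
          by (simp only: mult.assoc[symmetric])
      qed
      finally show ?thesis using True by simp
    qed simp
  qed
  also have "\<dots> = (\<integral>\<^sup>+x. (\<integral>\<^sup>+\<theta>. ennreal (f (Complex x (x * tan \<theta>)) * (x * inverse ((cos \<theta>)\<^sup>2)))
             * indicator S \<theta> * indicator {0<..} x \<partial>lborel) \<partial>lborel)"
    by (rule lborel_pair.Fubini') (simp add: tan_def)
  also have "\<dots> \<le> (\<integral>\<^sup>+x. \<integral>\<^sup>+y. ennreal (f (Complex x y)) \<partial>lborel \<partial>lborel)"
  proof (rule nn_integral_mono)
    fix x :: real
    show "(\<integral>\<^sup>+\<theta>. ennreal (f (Complex x (x * tan \<theta>)) * (x * inverse ((cos \<theta>)\<^sup>2)))
             * indicator S \<theta> * indicator {0<..} x \<partial>lborel)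
        \<le> (\<integral>\<^sup>+y. ennreal (f (Complex x y)) \<partial>lborel)"
    proof (cases "x > 0")
      case True
      have "(\<integral>\<^sup>+y. ennreal (f (Complex x y) * indicator {x * tan (-pi/4)..x * tan (pi/4)} y) \<partial>lborel)
        = (\<integral>\<^sup>+\<theta>. ennreal (f (Complex x (x * tan \<theta>)) * (x * inverse ((cos \<theta>)\<^sup>2))
             * indicator {-pi/4..pi/4} \<theta>) \<partial>lborel)"
      proof (rule nn_integral_substitution[where g = "\<lambda>\<theta>. x * tan \<theta>" and g' = "\<lambda>\<theta>. x * inverse ((cos \<theta>)\<^sup>2)"])
        show "set_borel_measurable borel {x * tan (- pi / 4)..x * tan (pi / 4)} (\<lambda>y. f (Complex x y))"
          unfolding set_borel_measurable_def by measurable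
        fix \<theta> assume "\<theta> \<in> {-pi/4..pi/4}"
        then have "cos \<theta> \<noteq> 0" using cos_pos[of \<theta>] by (simp add: S_def)
        then show "((\<lambda>\<theta>. x * tan \<theta>) has_real_derivative x * inverse ((cos \<theta>)\<^sup>2)) (at \<theta>)"
          by (intro DERIV_cmult DERIV_tan)
      next
        show "continuous_on {-pi/4..pi/4} (\<lambda>\<theta>. x * inverse ((cos \<theta>)\<^sup>2))"
          using cos_pos by (intro continuous_intros) (force simp: S_def)
      qed (use True in auto)
      moreover have "ennreal (u * indicator X v) = ennreal u * indicator X v" for u and X :: "real set" and v
        by (simp add: indicator_def)
      ultimately have "(\<integral>\<^sup>+\<theta>. ennreal (f (Complex x (x * tan \<theta>)) * (x * inverse ((cos \<theta>)\<^sup>2)))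
             * indicator S \<theta> * indicator {0<..} x \<partial>lborel)
        = (\<integral>\<^sup>+y. ennreal (f (Complex x y)) * indicator {x * tan (-pi/4)..x * tan (pi/4)} y \<partial>lborel)"
        using True by (simp add: S_def)
      also have "\<dots> \<le> (\<integral>\<^sup>+y. ennreal (f (Complex x y)) \<partial>lborel)"
        by (intro nn_integral_mono) (simp add: indicator_def)
      finally show ?thesis .
    qed simp
  qed
  also have "\<dots> = (\<integral>\<^sup>+z. ennreal (f z) \<partial>lborel)"
    by (simp add: nn_integral_complex)
  finally show ?thesis by (simp add: S_def)
qed

text \<open>
  Five quarter-plane sectors, rotated by powers of \<open>\<i>\<close>, cover the interval \<open>[0, 2\<pi>]\<close> of angles. They
  overlap, whence the factor \<open>5\<close>; only the finiteness of the left-hand side matters later.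
\<close>
lemma nn_integral_polar_le:
  fixes f :: "complex \<Rightarrow> real"
  assumes [measurable]: "f \<in> borel_measurable borel"
  shows "(\<integral>\<^sup>+\<theta>\<in>{0..2*pi}. \<integral>\<^sup>+r\<in>{0<..}. ennreal (r * f (rcis r \<theta>)) \<partial>lborel \<partial>lborel)
       \<le> 5 * (\<integral>\<^sup>+z. ennreal (f z) \<partial>lborel)"
proof -
  define H where "H \<theta> = (\<integral>\<^sup>+r\<in>{0<..}. ennreal (r * f (rcis r \<theta>)) \<partial>lborel)" for \<theta>
  have [measurable]: "H \<in> borel_measurable borel"
    unfolding H_def rcis_def cis.code by measurable
  define S where "S k = {-pi/4 + k * (pi/2)..pi/4 + k * (pi/2)}" for k
  have sector: "(\<integral>\<^sup>+\<theta>\<in>S k. H \<theta> \<partial>lborel) \<le> (\<integral>\<^sup>+z. ennreal (f z) \<partial>lborel)" for k :: nat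
  proof -
    have ind: "indicator (S k) (real k * (pi/2) + \<theta>) = (indicator {-pi/4..pi/4} \<theta> :: ennreal)" for \<theta>
      by (auto simp: S_def indicator_def)
    have rot: "rcis r (real k * (pi/2) + \<theta>) = \<i> ^ k * rcis r \<theta>" for r \<theta>
    proof -
      have "cis (real k * (pi/2)) = \<i> ^ k"
        using Complex.DeMoivre[of "pi/2" k] by (simp only: cis_pi_half)
      then show ?thesis by (simp add: rcis_def mult_ac flip: cis_mult)
    qed
    have "(\<integral>\<^sup>+\<theta>\<in>S k. H \<theta> \<partial>lborel)
        = (\<integral>\<^sup>+\<theta>\<in>{-pi/4..pi/4}. H (real k * (pi/2) + \<theta>) \<partial>lborel)"
      using nn_integral_real_affine[of "\<lambda>\<theta>. H \<theta> * indicator (S k) \<theta>" 1 "real k * (pi/2)"]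
      by (simp only: ind) (simp add: S_def)
    also have "\<dots> \<le> (\<integral>\<^sup>+z. ennreal (f (\<i> ^ k * z)) \<partial>lborel)"
      unfolding H_def rot by (rule polar_sector_le[of "\<lambda>z. f (\<i> ^ k * z)"]) simp
    also have "\<dots> = (\<integral>\<^sup>+z. ennreal (f z) \<partial>lborel)"
      by (rule nn_integral_mult_ii_power) simp
    finally show ?thesis .
  qed
  have cover: "indicator {0..2*pi} \<theta> \<le> (\<Sum>k<5::nat. indicator (S k) \<theta> :: ennreal)" for \<theta> :: real
  proof (cases "\<theta> \<in> {0..2*pi}")
    case True
    define k where "k = nat \<lfloor>\<theta> / (pi/2) + 1/2\<rfloor>"
    have ge: "\<theta> / (pi/2) + 1/2 \<ge> 0" using True by simp
    have "real k \<le> \<theta> / (pi/2) + 1/2" "\<theta> / (pi/2) + 1/2 < real k + 1"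
      unfolding k_def using ge by linarith+
    then have "real k * (pi/2) \<le> \<theta> + pi/4" "\<theta> + pi/4 \<le> real k * (pi/2) + pi/2"
      using pi_gt_zero by (simp_all add: field_simps)
    then have mem: "\<theta> \<in> S k" by (simp add: S_def)
    have "\<theta> / (pi/2) \<le> 4" using True by (simp add: field_simps)
    then have "k < 5" unfolding k_def using ge by linarith
    then have "indicator (S (real k)) \<theta> \<le> (\<Sum>k<5::nat. indicator (S k) \<theta> :: ennreal)"
      by (intro member_le_sum) auto
    with mem True show ?thesis by simp
  qed simp
  have "(\<integral>\<^sup>+\<theta>\<in>{0..2*pi}. H \<theta> \<partial>lborel) \<le> (\<integral>\<^sup>+\<theta>. (\<Sum>k<5::nat. H \<theta> * indicator (S k) \<theta>) \<partial>lborel)"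
    by (intro nn_integral_mono) (simp add: cover mult_left_mono flip: sum_distrib_left)
  also have "\<dots> = (\<Sum>k<5::nat. \<integral>\<^sup>+\<theta>\<in>S k. H \<theta> \<partial>lborel)"
    by (rule nn_integral_sum) (simp add: S_def)
  also have "\<dots> \<le> (\<Sum>k<5::nat. \<integral>\<^sup>+z. ennreal (f z) \<partial>lborel)"
    by (intro sum_mono sector)
  finally show ?thesis by (simp add: H_def)
qed

section \<open>Blaschke products and the defects of their factors\<close>

definition blaschke_factor :: "complex \<Rightarrow> complex \<Rightarrow> complex" where
  "blaschke_factor a z = cnj a / of_real (cmod a) * ((a - z) / (1 - cnj a * z))"

text \<open>
  By \<open>norm_blaschke_factor_sq\<close> below this is the amount by which \<open>|b\<^sub>a(z)|\<^sup>2\<close> falls short of \<open>1\<close>. On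
  each circle about \<open>0\<close> it is a multiple of a Poisson kernel, and near \<open>a\<close> it is bounded below.
\<close>
definition defect :: "complex \<Rightarrow> complex \<Rightarrow> real" where
  "defect a z = (1 - (cmod a)\<^sup>2) * (1 - (cmod z)\<^sup>2) / (cmod (1 - cnj a * z))\<^sup>2"

lemma one_minus_cnj_mult_nonzero:
  assumes "cmod a < 1" "cmod z < 1"
  shows "1 - cnj a * z \<noteq> 0"
proof
  assume "1 - cnj a * z = 0"
  then have "cmod a * cmod z = 1"
    by (metis complex_mod_cnj eq_iff_diff_eq_0 norm_mult norm_one)
  moreover have "cmod a * cmod z \<le> cmod a * 1"
    using assms by (intro mult_left_mono) auto
  ultimately show False using assms by simp
qed

lemma norm_blaschke_factor_sq:
  assumes "0 < cmod a" "cmod a < 1" "cmod z < 1"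
  shows "(cmod (blaschke_factor a z))\<^sup>2 = 1 - defect a z"
proof -
  have "(cmod (1 - cnj a * z))\<^sup>2 - (cmod (a - z))\<^sup>2 = (1 - (cmod a)\<^sup>2) * (1 - (cmod z)\<^sup>2)"
    unfolding cmod_power2 by (simp add: power2_eq_square algebra_simps)
  moreover have "cmod (blaschke_factor a z) = cmod (a - z) / cmod (1 - cnj a * z)"
    using assms(1) by (simp add: blaschke_factor_def norm_mult norm_divide)
  moreover have "(cmod (1 - cnj a * z))\<^sup>2 \<noteq> 0"
    using one_minus_cnj_mult_nonzero[OF assms(2,3)] by simp
  ultimately show ?thesis
    by (simp only: defect_def power_divide) (simp add: divide_simps)
qed

lemma defect_nonneg: "cmod a < 1 \<Longrightarrow> cmod z < 1 \<Longrightarrow> 0 \<le> defect a z"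
  by (auto simp: defect_def abs_square_le_1 intro!: divide_nonneg_nonneg mult_nonneg_nonneg)

lemma defect_le_1: "0 < cmod a \<Longrightarrow> cmod a < 1 \<Longrightarrow> cmod z < 1 \<Longrightarrow> defect a z \<le> 1"
  using norm_blaschke_factor_sq[of a z] by (metis diff_ge_0_iff_ge zero_le_power2)

lemma norm_one_minus_cnj_mult_ge:
  assumes "cmod a \<le> 1"
  shows "1 - cmod z \<le> cmod (1 - cnj a * z)"
proof -
  have "cmod a * cmod z \<le> 1 * cmod z" using assms by (intro mult_right_mono) auto
  moreover have "1 - cmod (cnj a * z) \<le> cmod (1 - cnj a * z)"
    by (metis norm_one norm_triangle_ineq2)
  ultimately show ?thesis by (simp add: norm_mult)
qed

lemma defect_le:
  assumes "cmod a < 1" "cmod z < 1"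
  shows "defect a z \<le> 4 * (1 - cmod a) / (1 - cmod z)"
proof -
  have 1: "1 - (cmod u)\<^sup>2 \<le> 2 * (1 - cmod u)" if "cmod u < 1" for u :: complex
    using sum_squares_ge_zero[of "1 - cmod u" 0] by (simp add: power2_eq_square algebra_simps)
  have "defect a z \<le> (2 * (1 - cmod a)) * (2 * (1 - cmod z)) / (1 - cmod z)\<^sup>2"
    unfolding defect_def using assms norm_one_minus_cnj_mult_ge[of a z]
    by (intro frac_le mult_mono power_mono 1) (auto simp: abs_square_le_1)
  also have "\<dots> = 4 * (1 - cmod a) / (1 - cmod z)"
    using assms by (simp add: power2_eq_square nonzero_divide_eq_eq nonzero_eq_divide_eq) (simp add: algebra_simps)
  finally show ?thesis .
qed

lemma norm_blaschke_factor_minus_1_le: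
  assumes "0 < cmod a" "cmod a < 1" "cmod z < 1"
  shows "cmod (blaschke_factor a z - 1) \<le> 2 * (1 - cmod a) / (1 - cmod z)"
proof -
  have nz: "1 - cnj a * z \<noteq> 0" using assms one_minus_cnj_mult_nonzero by blast
  have ca: "cnj a * a = of_real (cmod a) * of_real (cmod a)"
    using complex_norm_square[of a] by (simp add: power2_eq_square mult.commute)
  have "blaschke_factor a z - 1
      = - (of_real (1 - cmod a) * (of_real (cmod a) + cnj a * z)) / (of_real (cmod a) * (1 - cnj a * z))"
  proof -
    have "cnj a * (a - z) - of_real (cmod a) * (1 - cnj a * z)
        = - (of_real (1 - cmod a) * (of_real (cmod a) + cnj a * z))"
      using ca by (simp add: algebra_simps)
    moreover have "blaschke_factor a z - 1
        = (cnj a * (a - z) - of_real (cmod a) * (1 - cnj a * z)) / (of_real (cmod a) * (1 - cnj a * z))"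
      using nz assms(1) unfolding blaschke_factor_def
      by (subst diff_divide_distrib[of _ _ "of_real (cmod a) * (1 - cnj a * z)"]) simp
    ultimately show ?thesis by simp
  qed
  then have "cmod (blaschke_factor a z - 1)
      = (1 - cmod a) * cmod (of_real (cmod a) + cnj a * z) / (cmod a * cmod (1 - cnj a * z))"
    using assms by (simp only: norm_divide norm_mult norm_minus_cancel norm_of_real)
  also have "\<dots> \<le> (1 - cmod a) * (2 * cmod a) / (cmod a * (1 - cmod z))"
  proof (intro frac_le mult_left_mono)
    have "cmod (of_real (cmod a) + cnj a * z) \<le> cmod a + cmod a * cmod z"
      by (rule order_trans[OF norm_triangle_ineq]) (simp add: norm_mult)
    also have "\<dots> \<le> cmod a + cmod a * 1" using assms by (intro add_left_mono mult_left_mono) auto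
    finally show "cmod (of_real (cmod a) + cnj a * z) \<le> 2 * cmod a" by simp
  qed (use assms norm_one_minus_cnj_mult_ge[of a z] in auto)
  finally show ?thesis using assms by (simp add: mult_ac)
qed

lemma prod_one_minus_ge:
  fixes x :: "nat \<Rightarrow> real"
  assumes "\<And>n. 0 \<le> x n" "\<And>n. x n \<le> 1"
  shows "1 - (\<Sum>n<N. x n) \<le> (\<Prod>n<N. 1 - x n)"
proof (induction N)
  case (Suc N)
  have "(\<Prod>n<N. 1 - x n) \<le> 1" using assms by (intro prod_le_1) auto
  then have "x N * (\<Prod>n<N. 1 - x n) \<le> x N * 1" using assms by (intro mult_left_mono)
  with Suc show ?case by (simp add: algebra_simps)
qed simp

lemma prod_one_minus_le_exp:
  fixes x :: "nat \<Rightarrow> real"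
  assumes "\<And>n. x n \<le> 1"
  shows "(\<Prod>n<N. 1 - x n) \<le> exp (- (\<Sum>n<N. x n))"
proof -
  have "(\<Prod>n<N. 1 - x n) \<le> (\<Prod>n<N. exp (- x n))"
    using assms exp_ge_add_one_self[of "- x n" for n] by (intro prod_mono) (auto simp: algebra_simps)
  then show ?thesis by (simp add: exp_sum sum_negf[symmetric])
qed

text \<open>
  Absolute convergence of the product suffices here, because it tolerates finitely many vanishing factors;
  so the zeros of \<open>B\<close> need no special treatment.
\<close>
lemma blaschke_partial_products_LIMSEQ:
  assumes a: "blaschke_sequence a" and z: "cmod z < 1"
  shows "(\<lambda>N. \<Prod>n<N. blaschke_factor (a n) z) \<longlonglongrightarrow> blaschke_product a z"
proof -
  have a': "0 < cmod (a n)" "cmod (a n) < 1" "summable (\<lambda>n. 1 - cmod (a n))" for n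
    using a by (auto simp: blaschke_sequence_def)
  have "summable (\<lambda>n. 2 / (1 - cmod z) * (1 - cmod (a n)))"
    by (intro summable_mult a')
  then have "summable (\<lambda>n. cmod (blaschke_factor (a n) z - 1))"
    by (rule summable_comparison_test'[where N = 0])
      (use norm_blaschke_factor_minus_1_le[OF a'(1,2) z] in auto)
  then have "convergent_prod (\<lambda>n. blaschke_factor (a n) z)"
    by (intro abs_convergent_prod_imp_convergent_prod)
      (simp add: abs_convergent_prod_conv_summable)
  from convergent_prod_LIMSEQ[OF this] show ?thesis
    by (simp add: blaschke_product_def blaschke_factor_def LIMSEQ_lessThan_iff_atMost)
qed

lemma summable_defect:
  assumes "blaschke_sequence a" "cmod z < 1"
  shows "summable (\<lambda>n. defect (a n) z)"
proof -
  have "summable (\<lambda>n. 4 / (1 - cmod z) * (1 - cmod (a n)))"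
    using assms by (intro summable_mult) (simp add: blaschke_sequence_def)
  then show ?thesis
  proof (rule summable_comparison_test'[where N = 0])
    fix n
    have "cmod (a n) < 1" using assms by (simp add: blaschke_sequence_def)
    with defect_le[of "a n" z] defect_nonneg[of "a n" z] assms(2)
    show "norm (defect (a n) z) \<le> 4 / (1 - cmod z) * (1 - cmod (a n))" by simp
  qed
qed

text \<open>
  Both bounds pass to the limit from the finite products \<open>\<Prod> (1 - x\<^sub>n)\<close>. Together they say that \<open>|B|\<close> is
  close to \<open>1\<close> exactly where the sum of the defects is small.
\<close>
lemma
  assumes a: "blaschke_sequence a" and z: "cmod z < 1"
  shows norm_blaschke_product_sq_ge: "1 - (\<Sum>n. defect (a n) z) \<le> (cmod (blaschke_product a z))\<^sup>2"
    and norm_blaschke_product_sq_le: "(cmod (blaschke_product a z))\<^sup>2 \<le> exp (- (\<Sum>n. defect (a n) z))"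
proof -
  have a': "0 < cmod (a n)" "cmod (a n) < 1" for n
    using a by (auto simp: blaschke_sequence_def)
  have eq: "(cmod (\<Prod>n<N. blaschke_factor (a n) z))\<^sup>2 = (\<Prod>n<N. 1 - defect (a n) z)" for N
    using norm_blaschke_factor_sq[OF a' z] by (simp add: prod_norm[symmetric] prod_power_distrib)
  have lim: "(\<lambda>N. \<Prod>n<N. 1 - defect (a n) z) \<longlonglongrightarrow> (cmod (blaschke_product a z))\<^sup>2"
    unfolding eq[symmetric] by (intro tendsto_intros blaschke_partial_products_LIMSEQ assms)
  have sum: "(\<lambda>N. \<Sum>n<N. defect (a n) z) \<longlonglongrightarrow> (\<Sum>n. defect (a n) z)"
    by (rule summable_LIMSEQ[OF summable_defect[OF assms]])
  show "1 - (\<Sum>n. defect (a n) z) \<le> (cmod (blaschke_product a z))\<^sup>2"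
    by (rule LIMSEQ_le[OF tendsto_diff[OF tendsto_const sum] lim])
      (use prod_one_minus_ge[of "\<lambda>n. defect (a n) z"] defect_nonneg[OF a'(2) z] defect_le_1[OF a' z] in auto)
  show "(cmod (blaschke_product a z))\<^sup>2 \<le> exp (- (\<Sum>n. defect (a n) z))"
    by (rule LIMSEQ_le[OF lim tendsto_exp[OF tendsto_minus[OF sum]]])
      (use prod_one_minus_le_exp[of "\<lambda>n. defect (a n) z"] defect_le_1[OF a' z] in auto)
qed

lemma norm_blaschke_product_le_1:
  assumes "blaschke_sequence a" "cmod z < 1"
  shows "cmod (blaschke_product a z) \<le> 1"
proof -
  have "0 \<le> (\<Sum>n. defect (a n) z)"
    using assms by (intro suminf_nonneg summable_defect defect_nonneg) (auto simp: blaschke_sequence_def)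
  then have "exp (- (\<Sum>n. defect (a n) z)) \<le> 1\<^sup>2"
    by simp
  then have "(cmod (blaschke_product a z))\<^sup>2 \<le> 1\<^sup>2"
    by (rule order_trans[OF norm_blaschke_product_sq_le[OF assms]])
  then show ?thesis by (rule power2_le_imp_le) simp
qed

lemma holomorphic_blaschke_product:
  assumes a: "blaschke_sequence a"
  shows "blaschke_product a holomorphic_on unit_disc"
proof (rule holomorphic_uniform_sequence[where f = "\<lambda>N z. \<Prod>n<N. blaschke_factor (a n) z"])
  have a': "0 < cmod (a n)" "cmod (a n) < 1" "summable (\<lambda>n. 1 - cmod (a n))" for n
    using a by (auto simp: blaschke_sequence_def)
  have hol: "blaschke_factor (a n) holomorphic_on unit_disc" for n
    unfolding blaschke_factor_def using a'(1)[of n] one_minus_cnj_mult_nonzero[OF a'(2)]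
    by (intro holomorphic_intros) auto
  show "(\<lambda>z. \<Prod>n<N. blaschke_factor (a n) z) holomorphic_on unit_disc" for N
    by (intro holomorphic_intros hol)
  fix z :: complex assume "z \<in> unit_disc"
  then obtain d where d: "0 < d" "cball z d \<subseteq> unit_disc"
    by (meson open_ball open_contains_cball)
  have "uniformly_convergent_on (cball z d) (\<lambda>N z. \<Prod>n<N. blaschke_factor (a n) z)"
  proof (rule uniformly_convergent_on_prod')
    show "continuous_on (cball z d) (blaschke_factor (a n))" for n
      using holomorphic_on_imp_continuous_on[OF hol] d(2) continuous_on_subset by blast
    show "compact (cball z d)" by simp
    have "compact (cmod ` cball z d)"
      by (intro compact_continuous_image continuous_intros) simp
    moreover have "cmod ` cball z d \<noteq> {}" using d(1) by simp
    ultimately obtain w where w: "w \<in> cball z d" "\<And>v. v \<in> cball z d \<Longrightarrow> cmod v \<le> cmod w"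
      using compact_attains_sup[of "cmod ` cball z d"] by auto
    then have w1: "cmod w < 1" using d(2) by (auto simp: subset_iff)
    show "uniformly_convergent_on (cball z d) (\<lambda>N z. \<Sum>n<N. cmod (blaschke_factor (a n) z - 1))"
    proof (rule Weierstrass_m_test')
      show "summable (\<lambda>n. 2 / (1 - cmod w) * (1 - cmod (a n)))"
        by (intro summable_mult a')
      fix n v assume v: "v \<in> cball z d"
      have "cmod (blaschke_factor (a n) v - 1) \<le> 2 * (1 - cmod (a n)) / (1 - cmod v)"
        using v w1 w(2)[OF v] by (intro norm_blaschke_factor_minus_1_le a') auto
      also have "\<dots> \<le> 2 * (1 - cmod (a n)) / (1 - cmod w)"
        using w(2)[OF v] w1 a'(2)[of n] by (intro divide_left_mono mult_pos_pos) auto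
      finally show "norm (cmod (blaschke_factor (a n) v - 1)) \<le> 2 / (1 - cmod w) * (1 - cmod (a n))"
        by simp
    qed
  qed
  then obtain g where g: "uniform_limit (cball z d) (\<lambda>N z. \<Prod>n<N. blaschke_factor (a n) z) g sequentially"
    by (auto simp: uniformly_convergent_on_def)
  have "g v = blaschke_product a v" if "v \<in> cball z d" for v
    using LIMSEQ_unique[OF tendsto_uniform_limitI[OF g that] blaschke_partial_products_LIMSEQ[OF a]] that d(2)
    by (auto simp: subset_iff)
  then have "uniform_limit (cball z d) (\<lambda>N z. \<Prod>n<N. blaschke_factor (a n) z) (blaschke_product a) sequentially"
    using g by (simp add: uniform_limit_iff)
  then show "\<exists>d>0. cball z d \<subseteq> unit_disc \<and>
      uniform_limit (cball z d) (\<lambda>N z. \<Prod>n<N. blaschke_factor (a n) z) (blaschke_product a) sequentially"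
    using d by blast
qed simp

text \<open>
  Cauchy's inequality on the disc about \<open>z\<close> of half the distance to the boundary, which avoids a limit in
  the radius at the price of the factor \<open>2\<close>.
\<close>
lemma norm_deriv_le_of_bounded:
  assumes f: "f holomorphic_on unit_disc" "\<And>z. cmod z < 1 \<Longrightarrow> cmod (f z) \<le> 1" and z: "cmod z < 1"
  shows "cmod (deriv f z) \<le> 2 / (1 - cmod z)"
proof -
  define r where "r = (1 - cmod z) / 2"
  have r: "r > 0" using z by (simp add: r_def)
  have *: "cmod u < 1" if "cmod (z - u) \<le> r" for u
    using that z norm_triangle_ineq2[of u z] by (simp add: r_def norm_minus_commute)
  then have sub: "cball z r \<subseteq> unit_disc" by (auto simp: dist_norm)
  have "cmod ((deriv ^^ 1) f z) \<le> fact 1 * 1 / r ^ 1"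
  proof (rule Cauchy_inequality)
    show "f holomorphic_on ball z r"
      using f(1) sub by (meson ball_subset_cball holomorphic_on_subset order_trans)
    show "continuous_on (cball z r) f"
      using f(1) sub by (meson holomorphic_on_imp_continuous_on holomorphic_on_subset)
  qed (use r f(2) * in auto)
  then show ?thesis by (simp add: r_def)
qed

section \<open>Circular means of the defects\<close>

lemma borel_measurable_cis [measurable]:
  assumes [measurable]: "f \<in> borel_measurable M"
  shows "(\<lambda>x. cis (f x)) \<in> borel_measurable M"
  by (simp add: cis.code Complex_eq)

lemma borel_measurable_rcis [measurable]:
  assumes [measurable]: "f \<in> borel_measurable M" "g \<in> borel_measurable M"
  shows "(\<lambda>x. rcis (f x) (g x)) \<in> borel_measurable M"
  by (simp add: rcis_def)

lemma borel_measurable_defect [measurable]: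
  assumes [measurable]: "f \<in> borel_measurable M"
  shows "(\<lambda>x. defect a (f x)) \<in> borel_measurable M"
  by (simp add: defect_def)

text \<open>
  The kernel is the real part of \<open>(1 + u) / (1 - u)\<close> with \<open>u = w e\<^sup>i\<^sup>\<theta>\<close>, and \<open>\<theta> - 2 Im Ln (1 - u)\<close> is an
  antiderivative on the whole line, since \<open>1 - u\<close> stays in the right half-plane. Its logarithmic
  part is periodic.
\<close>
lemma nn_integral_poisson_kernel:
  assumes w: "cmod w < 1"
  shows "(\<integral>\<^sup>+\<theta>\<in>{0..2*pi}. ennreal ((1 - (cmod w)\<^sup>2) / (cmod (1 - w * cis \<theta>))\<^sup>2) \<partial>lborel) = ennreal (2 * pi)"
proof -
  define F where "F \<theta> = \<theta> - 2 * Im (Ln (1 - w * cis \<theta>))" for \<theta>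
  have small: "cmod (w * cis \<theta>) < 1" for \<theta> using w by (simp add: norm_mult)
  have Re_pos: "0 < Re (1 - w * cis \<theta>)" for \<theta>
    using small[of \<theta>] abs_Re_le_cmod[of "w * cis \<theta>"] by simp
  have deriv: "(F has_real_derivative (1 - (cmod w)\<^sup>2) / (cmod (1 - w * cis \<theta>))\<^sup>2) (at \<theta>)" for \<theta>
  proof -
    let ?u = "w * cis \<theta>"
    have nz: "1 - ?u \<noteq> 0" using small[of \<theta>] by (metis eq_iff_diff_eq_0 less_irrefl norm_one)
    have "((\<lambda>\<theta>. Ln (1 - w * cis \<theta>)) has_vector_derivative (- (w * (\<i> * cis \<theta>)) / (1 - ?u))) (at \<theta>)"
    proof -
      have cis: "(cis has_vector_derivative \<i> * cis \<theta>) (at \<theta>)"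
        unfolding has_vector_derivative_def by (auto intro!: derivative_eq_intros)
      have "((\<lambda>\<theta>. 1 - w * cis \<theta>) has_vector_derivative (- (w * (\<i> * cis \<theta>)))) (at \<theta>)"
        by (rule derivative_eq_intros cis | simp)+
      moreover have "(Ln has_field_derivative inverse (1 - ?u)) (at (1 - ?u))"
        using Re_pos[of \<theta>] by (intro has_field_derivative_Ln) (auto simp: complex_nonpos_Reals_iff)
      ultimately have "(Ln \<circ> (\<lambda>\<theta>. 1 - w * cis \<theta>) has_vector_derivative (- (w * (\<i> * cis \<theta>))) * inverse (1 - ?u)) (at \<theta>)"
        by (rule field_vector_diff_chain_at)
      then show ?thesis by (simp add: o_def field_simps)
    qed
    then have "((\<lambda>\<theta>. Im (Ln (1 - w * cis \<theta>))) has_real_derivative Im (- (w * (\<i> * cis \<theta>)) / (1 - ?u))) (at \<theta>)"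
      unfolding has_real_derivative_iff_has_vector_derivative
      by (rule bounded_linear.has_vector_derivative[OF bounded_linear_Im])
    then have "(F has_real_derivative 1 - 2 * Im (- (w * (\<i> * cis \<theta>)) / (1 - ?u))) (at \<theta>)"
      unfolding F_def by (intro DERIV_diff DERIV_ident DERIV_cmult)
    moreover have "1 - 2 * Im (- (w * (\<i> * cis \<theta>)) / (1 - ?u)) = (1 - (cmod w)\<^sup>2) / (cmod (1 - ?u))\<^sup>2"
    proof -
      have Im_rot: "Im (- \<i> * v) = - Re v" for v by simp
      have eq: "- (w * (\<i> * cis \<theta>)) / (1 - ?u) = - \<i> * (?u / (1 - ?u))" by simp
      have "1 - 2 * Im (- (w * (\<i> * cis \<theta>)) / (1 - ?u)) = 1 + 2 * Re (?u / (1 - ?u))"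
        unfolding eq by (simp only: Im_rot)
      also have "\<dots> = Re ((1 + ?u) / (1 - ?u))"
      proof -
        have "(1 + ?u) / (1 - ?u) = 1 + 2 * (?u / (1 - ?u))" using nz by (simp add: divide_simps)
        moreover have "Re (1 + 2 * v) = 1 + 2 * Re v" for v by simp
        ultimately show ?thesis by (simp only:)
      qed
      also have "\<dots> = (1 - (cmod ?u)\<^sup>2) / (cmod (1 - ?u))\<^sup>2"
        by (simp only: Re_divide cmod_power2) (simp add: power2_eq_square algebra_simps add_divide_distrib[symmetric] diff_divide_distrib[symmetric])
      finally show ?thesis by (simp add: norm_mult)
    qed
    ultimately show ?thesis by simp
  qed
  have "(\<integral>\<^sup>+\<theta>. ennreal ((1 - (cmod w)\<^sup>2) / (cmod (1 - w * cis \<theta>))\<^sup>2) * indicator {0..2*pi} \<theta> \<partial>lborel) = ennreal (F (2*pi) - F 0)"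
    using w by (intro nn_integral_FTC_Icc deriv) (auto simp: abs_square_le_1)
  then show ?thesis by (simp add: F_def)
qed

lemma nn_integral_defect_circle:
  assumes a: "cmod a < 1" and r: "0 \<le> r" "r < 1"
  shows "(\<integral>\<^sup>+\<theta>\<in>{0..2*pi}. ennreal (defect a (rcis r \<theta>)) \<partial>lborel)
       = ennreal (2 * pi * ((1 - (cmod a)\<^sup>2) * (1 - r\<^sup>2) / (1 - (cmod a)\<^sup>2 * r\<^sup>2)))"
proof -
  define w where "w = cnj a * of_real r"
  define c where "c = (1 - (cmod a)\<^sup>2) * (1 - r\<^sup>2) / (1 - (cmod w)\<^sup>2)"
  have cw: "cmod w = cmod a * r" using r by (simp add: w_def norm_mult)
  have w1: "cmod w < 1" using mult_strict_mono'[OF a r(2)] r by (simp add: cw)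
  have w2: "1 - (cmod w)\<^sup>2 > 0" using w1 by (simp add: abs_square_less_1)
  have c0: "c \<ge> 0" unfolding c_def using a r w2
    by (intro divide_nonneg_pos mult_nonneg_nonneg) (auto simp: abs_square_le_1)
  have "(\<integral>\<^sup>+\<theta>\<in>{0..2*pi}. ennreal (defect a (rcis r \<theta>)) \<partial>lborel)
     = (\<integral>\<^sup>+\<theta>. ennreal c * (ennreal ((1 - (cmod w)\<^sup>2) / (cmod (1 - w * cis \<theta>))\<^sup>2) * indicator {0..2*pi} \<theta>) \<partial>lborel)"
  proof (intro nn_integral_cong)
    fix \<theta>
    have "defect a (rcis r \<theta>) = c * ((1 - (cmod w)\<^sup>2) / (cmod (1 - w * cis \<theta>))\<^sup>2)"
      using w2 by (simp add: defect_def c_def w_def rcis_def mult.assoc norm_mult)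
    then show "ennreal (defect a (rcis r \<theta>)) * indicator {0..2*pi} \<theta>
      = ennreal c * (ennreal ((1 - (cmod w)\<^sup>2) / (cmod (1 - w * cis \<theta>))\<^sup>2) * indicator {0..2*pi} \<theta>)"
      by (simp only: ennreal_mult'[OF c0] mult.assoc)
  qed
  also have "\<dots> = ennreal c * ennreal (2 * pi)"
    by (subst nn_integral_cmult) (simp_all add: nn_integral_poisson_kernel[OF w1])
  also have "\<dots> = ennreal (2 * pi * c)" using c0 by (simp add: ennreal_mult'[symmetric] mult.commute)
  finally show ?thesis by (simp add: c_def cw power_mult_distrib)
qed

text \<open>
  The circular means of the defects: each tends to \<open>0\<close> and the \<open>n\<close>-th is at most \<open>2 (1 - |a\<^sub>n|)\<close>, so
  Tannery's theorem applies.
\<close>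
lemma suminf_poisson_mean_tendsto_0:
  assumes a: "blaschke_sequence a" and r: "\<And>j. 0 \<le> r j" "\<And>j. r j < 1" "r \<longlonglongrightarrow> 1"
  defines "m \<equiv> \<lambda>n j. (1 - (cmod (a n))\<^sup>2) * (1 - (r j)\<^sup>2) / (1 - (cmod (a n))\<^sup>2 * (r j)\<^sup>2)"
  shows "(\<And>j. summable (\<lambda>n. m n j))" "(\<And>n j. 0 \<le> m n j)" "(\<lambda>j. \<Sum>n. m n j) \<longlonglongrightarrow> 0"
proof -
  have a1: "cmod (a n) < 1" "summable (\<lambda>n. 1 - cmod (a n))" for n
    using a by (auto simp: blaschke_sequence_def)
  have le: "1 - (r j)\<^sup>2 \<le> 1 - (cmod (a n))\<^sup>2 * (r j)\<^sup>2" for n j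
    using a1(1)[of n] by (simp add: mult_left_le_one_le abs_square_le_1)
  have r2: "0 < 1 - (r j)\<^sup>2" for j using r(1,2)[of j] by (simp add: abs_square_less_1)
  have a2: "0 \<le> 1 - (cmod (a n))\<^sup>2" for n using a1(1)[of n] by (simp add: abs_square_le_1)
  show nonneg: "0 \<le> m n j" for n j
    unfolding m_def using r2[of j] le[of j n] a2[of n] by (intro divide_nonneg_pos mult_nonneg_nonneg) auto
  have bound: "m n j \<le> 2 * (1 - cmod (a n))" for n j
  proof -
    have "m n j \<le> (1 - (cmod (a n))\<^sup>2) * (1 - (cmod (a n))\<^sup>2 * (r j)\<^sup>2) / (1 - (cmod (a n))\<^sup>2 * (r j)\<^sup>2)"
      unfolding m_def using r2[of j] le[of j n] a2[of n] by (intro divide_right_mono mult_left_mono) auto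
    also have "\<dots> = 1 - (cmod (a n))\<^sup>2" using r2[of j] le[of j n] by simp
    also have "\<dots> \<le> 2 * (1 - cmod (a n))"
      using sum_squares_ge_zero[of "1 - cmod (a n)" 0] by (simp add: power2_eq_square algebra_simps)
    finally show ?thesis .
  qed
  have sum: "summable (\<lambda>n. 2 * (1 - cmod (a n)))" by (intro summable_mult a1)
  show "summable (\<lambda>n. m n j)" for j
    by (rule summable_comparison_test'[OF sum, where N = 0]) (use bound nonneg in auto)
  have "(\<lambda>j. m n j) \<longlonglongrightarrow> (1 - (cmod (a n))\<^sup>2) * (1 - 1\<^sup>2) / (1 - (cmod (a n))\<^sup>2 * 1\<^sup>2)" for n
    unfolding m_def using a1(1)[of n] by (intro tendsto_intros r) (simp add: abs_square_eq_1)
  then have "(\<lambda>j. m n j) \<longlonglongrightarrow> 0" for n by simp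
  moreover have "eventually (\<lambda>(n, j). norm (m n j) \<le> 2 * (1 - cmod (a n))) (at_top \<times>\<^sub>F sequentially)"
    by (rule always_eventually) (use bound nonneg in auto)
  ultimately have "(\<lambda>j. \<Sum>n. m n j) \<longlonglongrightarrow> (\<Sum>n. 0)"
    using tannerys_theorem[where a = m and b = "\<lambda>_. 0", OF _ _ sum sequentially_bot] by blast
  then show "(\<lambda>j. \<Sum>n. m n j) \<longlonglongrightarrow> 0" by simp
qed

text \<open>
  Fatou's lemma turns the convergence of the means to \<open>0\<close> into a statement on almost every radius. It
  takes the place of the theorem that the radial limits of \<open>B\<close> are unimodular almost everywhere.
\<close>
lemma AE_liminf_suminf_defect_eq_0:
  assumes a: "blaschke_sequence a" and r: "\<And>j. 0 \<le> r j" "\<And>j. r j < 1" "r \<longlonglongrightarrow> 1"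
  shows "AE \<theta> in lborel. \<theta> \<in> {0..2*pi} \<longrightarrow>
           liminf (\<lambda>j. ennreal (\<Sum>n. defect (a n) (rcis (r j) \<theta>))) = 0"
proof -
  have a1: "cmod (a n) < 1" for n using a by (auto simp: blaschke_sequence_def)
  define u where "u j \<theta> = (\<Sum>n. ennreal (defect (a n) (rcis (r j) \<theta>))) * indicator {0..2*pi} \<theta>" for j \<theta>
  define m where "m n j = (1 - (cmod (a n))\<^sup>2) * (1 - (r j)\<^sup>2) / (1 - (cmod (a n))\<^sup>2 * (r j)\<^sup>2)" for n j
  note m = suminf_poisson_mean_tendsto_0[OF a r, folded m_def]
  have [measurable]: "u j \<in> borel_measurable borel" for j
    unfolding u_def by measurable
  have int_u: "(\<integral>\<^sup>+\<theta>. u j \<theta> \<partial>lborel) = ennreal (2 * pi * (\<Sum>n. m n j))" for j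
  proof -
    have "(\<integral>\<^sup>+\<theta>. u j \<theta> \<partial>lborel) = (\<Sum>n. \<integral>\<^sup>+\<theta>\<in>{0..2*pi}. ennreal (defect (a n) (rcis (r j) \<theta>)) \<partial>lborel)"
      unfolding u_def ennreal_suminf_multc[symmetric] by (subst nn_integral_suminf) simp_all
    also have "\<dots> = (\<Sum>n. ennreal (2 * pi * m n j))"
      by (simp only: nn_integral_defect_circle[OF a1 r(1,2)] m_def)
    also have "\<dots> = ennreal (\<Sum>n. 2 * pi * m n j)"
      using m by (intro suminf_ennreal2 summable_mult mult_nonneg_nonneg) auto
    finally show ?thesis using m by (simp add: suminf_mult)
  qed
  have "(\<integral>\<^sup>+\<theta>. liminf (\<lambda>j. u j \<theta>) \<partial>lborel) \<le> liminf (\<lambda>j. \<integral>\<^sup>+\<theta>. u j \<theta> \<partial>lborel)"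
    by (rule nn_integral_liminf) simp
  also have "\<dots> = 0"
  proof (intro lim_imp_Liminf)
    have "(\<lambda>j. ennreal (2 * pi * (\<Sum>n. m n j))) \<longlonglongrightarrow> ennreal (2 * pi * 0)"
      by (intro tendsto_intros m)
    then show "(\<lambda>j. \<integral>\<^sup>+\<theta>. u j \<theta> \<partial>lborel) \<longlonglongrightarrow> 0" by (simp add: int_u)
  qed simp
  finally have "(\<integral>\<^sup>+\<theta>. liminf (\<lambda>j. u j \<theta>) \<partial>lborel) = 0" by simp
  then have "AE \<theta> in lborel. liminf (\<lambda>j. u j \<theta>) = 0"
    by (subst (asm) nn_integral_0_iff_AE) auto
  then show ?thesis
  proof (eventually_elim, intro impI)
    fix \<theta> assume 0: "liminf (\<lambda>j. u j \<theta>) = 0" and \<theta>: "\<theta> \<in> {0..2*pi}"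
    have "u j \<theta> = ennreal (\<Sum>n. defect (a n) (rcis (r j) \<theta>))" for j
      unfolding u_def using \<theta> r(1,2)[of j]
      by (subst suminf_ennreal2) (auto intro!: defect_nonneg summable_defect a a1)
    with 0 show "liminf (\<lambda>j. ennreal (\<Sum>n. defect (a n) (rcis (r j) \<theta>))) = 0" by simp
  qed
qed

section \<open>Energy of the derivative along a radius\<close>

lemma norm_diff_le_nn_integral_deriv:
  assumes f: "f holomorphic_on unit_disc" and uv: "0 < u" "u \<le> v" "v \<le> 1"
  shows "ennreal (cmod (f (rcis (1 - u) \<theta>) - f (rcis (1 - v) \<theta>)))
       \<le> (\<integral>\<^sup>+t\<in>{u..v}. ennreal (cmod (deriv f (rcis (1 - t) \<theta>))) \<partial>lborel)"
proof -
  define h where "h t = cmod (deriv f (rcis (1 - t) \<theta>))" for t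
  have in_disc: "rcis (1 - t) \<theta> \<in> unit_disc" if "t \<in> {u..v}" for t
    using that uv by simp
  have hol': "deriv f holomorphic_on unit_disc"
    using f by (intro holomorphic_deriv) auto
  have cont: "continuous_on {u..v} (\<lambda>t. deriv f (rcis (1 - t) \<theta>))"
  proof (rule continuous_on_compose2[OF holomorphic_on_imp_continuous_on[OF hol']])
    show "continuous_on {u..v} (\<lambda>t. rcis (1 - t) \<theta>)"
      unfolding rcis_def by (intro continuous_intros)
  qed (use in_disc in auto)
  have deriv: "((\<lambda>t. f (rcis (1 - t) \<theta>)) has_vector_derivative - cis \<theta> * deriv f (rcis (1 - t) \<theta>)) (at t within {u..v})"
    if "t \<in> {u..v}" for t
  proof -
    have "((\<lambda>t. rcis (1 - t) \<theta>) has_vector_derivative - cis \<theta>) (at t within {u..v})"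
      unfolding rcis_def by (auto intro!: derivative_eq_intros)
    moreover have "(f has_field_derivative deriv f (rcis (1 - t) \<theta>)) (at (rcis (1 - t) \<theta>))"
      using f in_disc[OF that] by (intro holomorphic_derivI[where S = unit_disc]) auto
    ultimately have "(f \<circ> (\<lambda>t. rcis (1 - t) \<theta>) has_vector_derivative - cis \<theta> * deriv f (rcis (1 - t) \<theta>)) (at t within {u..v})"
      by (intro field_vector_diff_chain_within) (auto intro: has_field_derivative_at_within)
    then show ?thesis by (simp add: o_def)
  qed
  have "((\<lambda>t. - cis \<theta> * deriv f (rcis (1 - t) \<theta>)) has_integral f (rcis (1 - v) \<theta>) - f (rcis (1 - u) \<theta>)) {u..v}"
    using uv deriv by (intro fundamental_theorem_of_calculus) auto
  moreover have hint: "(h has_integral integral {u..v} h) {u..v}"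
    unfolding h_def using cont
    by (intro integrable_integral integrable_continuous_interval continuous_intros)
  ultimately have "cmod (f (rcis (1 - v) \<theta>) - f (rcis (1 - u) \<theta>)) \<le> integral {u..v} h"
    using Henstock_Kurzweil_Integration.integral_norm_bound_integral
      [of "\<lambda>t. - cis \<theta> * deriv f (rcis (1 - t) \<theta>)" "{u..v}" h]
    by (auto simp: h_def norm_mult has_integral_iff)
  then have "ennreal (cmod (f (rcis (1 - u) \<theta>) - f (rcis (1 - v) \<theta>))) \<le> ennreal (integral {u..v} h)"
    by (simp add: norm_minus_commute ennreal_leI)
  also have "ennreal (integral {u..v} h) = (\<integral>\<^sup>+t\<in>{u..v}. ennreal (h t) \<partial>lborel)"
    using nn_integral_has_integral_lebesgue'[OF _ hint] by (simp add: h_def)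
  finally show ?thesis by (simp add: h_def)
qed

lemma powr_bound_p_le_1:
  fixes x p t :: real
  assumes "0 \<le> x" "0 < t" "x \<le> 2 / t" "0 < p" "p \<le> 1"
  shows "x \<le> 2 * x powr p * t powr (p - 1)"
proof (cases "x = 0")
  case False
  have "x = x powr p * x powr (1 - p)" using False assms by (simp flip: powr_add)
  also have "\<dots> \<le> x powr p * (2 / t) powr (1 - p)"
    using assms by (intro mult_left_mono powr_mono2) auto
  also have "(2 / t) powr (1 - p) = 2 powr (1 - p) * t powr (p - 1)"
    using assms powr_minus_divide[of t "1 - p"] by (simp add: powr_divide)
  also have "2 powr (1 - p) \<le> (2::real) powr 1" using assms by (intro powr_mono) auto
  finally show ?thesis using assms by (simp add: mult_ac mult_left_mono mult_right_mono)
qed (use assms in simp)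

lemma le_threshold_plus:
  fixes x p \<eta> :: real
  assumes "0 \<le> x" "0 < \<eta>" "1 < p"
  shows "x \<le> \<eta> + \<eta> powr (1 - p) * x powr p"
proof (cases "x \<le> \<eta>")
  case True
  then show ?thesis by (simp add: add_increasing2)
next
  case False
  have "x = x powr (1 - p) * x powr p" using False assms by (simp flip: powr_add)
  also have "\<dots> \<le> \<eta> powr (1 - p) * x powr p"
    using False assms by (intro mult_right_mono powr_mono2') auto
  finally show ?thesis using assms by simp
qed

lemma nn_integral_powr_le:
  assumes "0 < u" "u \<le> T" "0 < \<kappa>"
  shows "(\<integral>\<^sup>+t\<in>{u..T}. ennreal (t powr (\<kappa> - 1)) \<partial>lborel) \<le> ennreal (T powr \<kappa> / \<kappa>)"
proof -
  have "(\<integral>\<^sup>+t\<in>{u..T}. ennreal (t powr (\<kappa> - 1)) \<partial>lborel) = ennreal (T powr \<kappa> / \<kappa> - u powr \<kappa> / \<kappa>)"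
  proof (rule nn_integral_FTC_Icc)
    fix t assume "t \<in> {u..T}"
    then show "((\<lambda>t. t powr \<kappa> / \<kappa>) has_real_derivative t powr (\<kappa> - 1)) (at t)"
      using assms by (auto intro!: derivative_eq_intros)
  qed (use assms in auto)
  also have "\<dots> \<le> ennreal (T powr \<kappa> / \<kappa>)"
    using assms by (intro ennreal_leI) simp
  finally show ?thesis .
qed

text \<open>
  This is where the exponent \<open>s\<close> appears; \<open>h\<close> will be \<open>|B'|\<close> along a radius. If \<open>p \<le> 1\<close>, the bound
  \<open>h \<le> 2/t\<close> gives \<open>h \<le> 2 h\<^sup>p t\<^sup>p\<^sup>-\<^sup>1\<close>, and \<open>t\<^sup>p\<^sup>-\<^sup>1 \<le> T\<^sup>s t\<^sup>\<alpha>\<close> for \<open>t \<le> T\<close>. If \<open>p > 1\<close>, split the values of \<open>h\<close>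
  at a threshold \<open>\<eta>(t)\<close>: above it \<open>h \<le> \<eta>\<^sup>1\<^sup>-\<^sup>p h\<^sup>p\<close>. The threshold is chosen so that \<open>\<eta>\<^sup>1\<^sup>-\<^sup>p\<close> is a multiple of
  \<open>T\<^sup>s t\<^sup>\<alpha>\<close>; then \<open>\<eta>\<close> is proportional to \<open>T\<^sup>-\<^sup>\<kappa> t\<^sup>\<kappa>\<^sup>-\<^sup>1\<close> with \<open>\<kappa> = s / (p - 1) > 0\<close>, so its integral up to \<open>T\<close>
  does not depend on \<open>T\<close> and can be made at most \<open>\<delta>/2\<close>.
\<close>
lemma energy_ge_of_total_variation_ge:
  fixes p \<alpha> \<delta> :: real
  defines "s \<equiv> p - 1 - \<alpha>"
  assumes p: "0 < p" and s: "0 < s" and \<delta>: "0 < \<delta>"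
  obtains c where "0 < c"
    "\<And>h u T. h \<in> borel_measurable borel \<Longrightarrow> 0 < u \<Longrightarrow> u \<le> T \<Longrightarrow>
       (\<And>t. t \<in> {u..T} \<Longrightarrow> 0 \<le> h t \<and> h t \<le> 2 / t) \<Longrightarrow>
       ennreal \<delta> \<le> (\<integral>\<^sup>+t\<in>{u..T}. ennreal (h t) \<partial>lborel) \<Longrightarrow>
       ennreal (c * T powr - s) \<le> (\<integral>\<^sup>+t\<in>{u..T}. ennreal (h t powr p * t powr \<alpha>) \<partial>lborel)"
proof -
  (* It suffices to dominate h by an integrable threshold plus a multiple of the energy density. *)
  have "\<exists>K>0. \<forall>u T. 0 < u \<and> u \<le> T \<longrightarrow> (\<exists>\<eta> \<in> borel_measurable borel.
      (\<integral>\<^sup>+t\<in>{u..T}. ennreal (\<eta> t) \<partial>lborel) \<le> ennreal (\<delta> / 2) \<and>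
      (\<forall>x t. t \<in> {u..T} \<and> 0 \<le> x \<and> x \<le> 2 / t \<longrightarrow>
         0 \<le> \<eta> t \<and> x \<le> \<eta> t + K * T powr s * (x powr p * t powr \<alpha>)))"
  proof (cases "p \<le> 1")
    case True
    have "x \<le> 0 + 2 * T powr s * (x powr p * t powr \<alpha>)"
      if "0 < u" "t \<in> {u..T}" "0 \<le> x" "x \<le> 2 / t" for x t u T
    proof -
      have t: "0 < t" "t \<le> T" using that by auto
      have "t powr (p - 1) = t powr s * t powr \<alpha>" by (simp add: s_def flip: powr_add)
      also have "\<dots> \<le> T powr s * t powr \<alpha>"
        using t s by (intro mult_right_mono powr_mono2) auto
      finally have "2 * x powr p * t powr (p - 1) \<le> 2 * x powr p * (T powr s * t powr \<alpha>)"
        by (intro mult_left_mono) auto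
      with powr_bound_p_le_1[OF that(3) t(1) that(4) p True] show ?thesis
        by (simp add: mult_ac)
    qed
    then show ?thesis
      using \<delta> by (intro exI[of _ 2] conjI allI impI bexI[of _ "\<lambda>_. 0"]) auto
  next
    case False
    define \<kappa> where "\<kappa> = s / (p - 1)"
    define \<epsilon> where "\<epsilon> = \<kappa> * \<delta> / 2"
    have \<kappa>: "0 < \<kappa>" using False s by (simp add: \<kappa>_def)
    have \<epsilon>: "0 < \<epsilon>" using \<kappa> \<delta> by (simp add: \<epsilon>_def)
    have \<kappa>_alt: "\<kappa> - 1 = - \<alpha> / (p - 1)" using False by (simp add: \<kappa>_def s_def field_simps)
    show ?thesis
    proof (intro exI[of _ "\<epsilon> powr (1 - p)"] conjI allI impI)
      show "0 < \<epsilon> powr (1 - p)" using \<epsilon> by simp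
      fix u T :: real assume uT: "0 < u \<and> u \<le> T"
      then have T: "0 < T" by auto
      define \<eta> where "\<eta> t = \<epsilon> * T powr - \<kappa> * t powr (\<kappa> - 1)" for t :: real
      show "\<exists>\<eta> \<in> borel_measurable borel.
        (\<integral>\<^sup>+t\<in>{u..T}. ennreal (\<eta> t) \<partial>lborel) \<le> ennreal (\<delta> / 2) \<and>
        (\<forall>x t. t \<in> {u..T} \<and> 0 \<le> x \<and> x \<le> 2 / t \<longrightarrow>
           0 \<le> \<eta> t \<and> x \<le> \<eta> t + \<epsilon> powr (1 - p) * T powr s * (x powr p * t powr \<alpha>))"
      proof (intro bexI[of _ \<eta>] conjI allI impI)
        have "(\<integral>\<^sup>+t\<in>{u..T}. ennreal (\<eta> t) \<partial>lborel)
            = (\<integral>\<^sup>+t. ennreal (\<epsilon> * T powr - \<kappa>) * (ennreal (t powr (\<kappa> - 1)) * indicator {u..T} t) \<partial>lborel)"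
          unfolding \<eta>_def using \<epsilon> by (simp add: ennreal_mult' mult.assoc)
        also have "\<dots> = ennreal (\<epsilon> * T powr - \<kappa>) * (\<integral>\<^sup>+t\<in>{u..T}. ennreal (t powr (\<kappa> - 1)) \<partial>lborel)"
          by (rule nn_integral_cmult) simp
        also have "\<dots> \<le> ennreal (\<epsilon> * T powr - \<kappa>) * ennreal (T powr \<kappa> / \<kappa>)"
          using uT \<kappa> by (intro mult_left_mono nn_integral_powr_le) auto
        also have "\<dots> = ennreal (\<epsilon> * T powr - \<kappa> * (T powr \<kappa> / \<kappa>))"
          using \<epsilon> by (intro ennreal_mult'[symmetric]) simp
        also have "\<epsilon> * T powr - \<kappa> * (T powr \<kappa> / \<kappa>) = \<delta> / 2"
          using T \<kappa> by (simp add: powr_minus \<epsilon>_def field_simps)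
        finally show "(\<integral>\<^sup>+t\<in>{u..T}. ennreal (\<eta> t) \<partial>lborel) \<le> ennreal (\<delta> / 2)" .
        fix x t assume xt: "t \<in> {u..T} \<and> 0 \<le> x \<and> x \<le> 2 / t"
        then have t: "0 < t" using uT by auto
        then have \<eta>_pos: "0 < \<eta> t" using \<epsilon> T by (simp add: \<eta>_def)
        then show "0 \<le> \<eta> t" by simp
        have "\<eta> t powr (1 - p) = \<epsilon> powr (1 - p) * T powr (- \<kappa> * (1 - p)) * t powr ((\<kappa> - 1) * (1 - p))"
          unfolding \<eta>_def using \<epsilon> by (simp add: powr_mult powr_powr)
        also have "- \<kappa> * (1 - p) = s" using False by (simp add: \<kappa>_def field_simps)
        also have "(\<kappa> - 1) * (1 - p) = \<alpha>" unfolding \<kappa>_alt using False by (simp add: field_simps)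
        finally show "x \<le> \<eta> t + \<epsilon> powr (1 - p) * T powr s * (x powr p * t powr \<alpha>)"
          using le_threshold_plus[of x "\<eta> t" p] xt \<eta>_pos False by (simp add: mult_ac)
      qed (simp add: \<eta>_def[abs_def])
    qed
  qed
  then obtain K where K: "0 < K" and dom: "\<And>u T. 0 < u \<Longrightarrow> u \<le> T \<Longrightarrow> \<exists>\<eta> \<in> borel_measurable borel.
      (\<integral>\<^sup>+t\<in>{u..T}. ennreal (\<eta> t) \<partial>lborel) \<le> ennreal (\<delta> / 2) \<and>
      (\<forall>x t. t \<in> {u..T} \<and> 0 \<le> x \<and> x \<le> 2 / t \<longrightarrow>
         0 \<le> \<eta> t \<and> x \<le> \<eta> t + K * T powr s * (x powr p * t powr \<alpha>))"
    by blast
  show thesis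
  proof (rule that[of "\<delta> / (2 * K)"])
    show "0 < \<delta> / (2 * K)" using \<delta> K by simp
    fix h :: "real \<Rightarrow> real" and u T :: real
    assume [measurable]: "h \<in> borel_measurable borel" and uT: "0 < u" "u \<le> T"
      and h: "\<And>t. t \<in> {u..T} \<Longrightarrow> 0 \<le> h t \<and> h t \<le> 2 / t"
      and var: "ennreal \<delta> \<le> (\<integral>\<^sup>+t\<in>{u..T}. ennreal (h t) \<partial>lborel)"
    from dom[OF uT] obtain \<eta> where [measurable]: "\<eta> \<in> borel_measurable borel"
      and \<eta>: "(\<integral>\<^sup>+t\<in>{u..T}. ennreal (\<eta> t) \<partial>lborel) \<le> ennreal (\<delta> / 2)"
      and dom': "\<And>x t. t \<in> {u..T} \<Longrightarrow> 0 \<le> x \<Longrightarrow> x \<le> 2 / t \<Longrightarrow>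
         0 \<le> \<eta> t \<and> x \<le> \<eta> t + K * T powr s * (x powr p * t powr \<alpha>)"
      by blast
    define J where "J = (\<integral>\<^sup>+t\<in>{u..T}. ennreal (h t powr p * t powr \<alpha>) \<partial>lborel)"
    have C: "0 < K * T powr s" using K uT by simp
    have "ennreal \<delta> \<le> (\<integral>\<^sup>+t. ennreal (\<eta> t) * indicator {u..T} t
          + ennreal (K * T powr s) * (ennreal (h t powr p * t powr \<alpha>) * indicator {u..T} t) \<partial>lborel)"
    proof (rule order_trans[OF var nn_integral_mono])
      fix t
      show "ennreal (h t) * indicator {u..T} t \<le> ennreal (\<eta> t) * indicator {u..T} t
          + ennreal (K * T powr s) * (ennreal (h t powr p * t powr \<alpha>) * indicator {u..T} t)"
      proof (cases "t \<in> {u..T}")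
        case True
        have *: "0 \<le> \<eta> t" "h t \<le> \<eta> t + K * T powr s * (h t powr p * t powr \<alpha>)"
          using dom'[OF True] h[OF True] by auto
        have "ennreal (h t) \<le> ennreal (\<eta> t + K * T powr s * (h t powr p * t powr \<alpha>))"
          using * by (intro ennreal_leI)
        also have "\<dots> = ennreal (\<eta> t) + ennreal (K * T powr s * (h t powr p * t powr \<alpha>))"
          using * C by (intro ennreal_plus) auto
        also have "\<dots> = ennreal (\<eta> t) + ennreal (K * T powr s) * ennreal (h t powr p * t powr \<alpha>)"
          using C by (subst ennreal_mult'[of "K * T powr s"]) auto
        finally show ?thesis using True by simp
      qed simp
    qed
    also have "\<dots> = (\<integral>\<^sup>+t\<in>{u..T}. ennreal (\<eta> t) \<partial>lborel) + ennreal (K * T powr s) * J"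
      unfolding J_def by (subst nn_integral_add) (simp_all add: nn_integral_cmult)
    also have "\<dots> \<le> ennreal (\<delta> / 2) + ennreal (K * T powr s) * J"
      by (intro add_right_mono \<eta>)
    finally have main: "ennreal \<delta> \<le> ennreal (\<delta> / 2) + ennreal (K * T powr s) * J" .
    show "ennreal (\<delta> / (2 * K) * T powr - s) \<le> J"
    proof (cases J)
      case (real j)
      have "ennreal \<delta> \<le> ennreal (\<delta> / 2 + K * T powr s * j)"
        using main \<delta> C real by (simp add: ennreal_mult')
      then have "\<delta> \<le> \<delta> / 2 + K * T powr s * j"
        using \<delta> C real by (subst (asm) ennreal_le_iff) (auto intro!: add_nonneg_nonneg)
      then have "\<delta> / (2 * K) * T powr - s \<le> j"
        using K C uT by (simp add: powr_minus field_simps)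
      then show ?thesis using real by (simp add: ennreal_leI)
    qed simp
  qed
qed

text \<open>
  Where the defects sum to at least \<open>c0\<close>, \<open>|B| \<le> exp (-c0/2)\<close>; nearer to the boundary on the same radius
  there is a point with \<open>|B| \<ge> 1 - \<delta>\<close>. The value of \<open>\<delta>\<close> is half of \<open>1 - exp (-c0/2)\<close>, so \<open>B\<close> varies by
  at least \<open>\<delta>\<close> in between. The function \<open>D\<close> is a globally measurable version of \<open>|B'|\<close>.
\<close>
lemma AE_radial_energy_ge:
  fixes p \<alpha> c0 :: real
  defines "s \<equiv> p - 1 - \<alpha>"
  assumes a: "blaschke_sequence a" and p: "0 < p" and s: "0 < s" and c0: "0 < c0"
    and [measurable]: "D \<in> borel_measurable borel"
    and D: "\<And>z. cmod z < 1 \<Longrightarrow> D z = cmod (deriv (blaschke_product a) z)"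
  obtains c where "0 < c"
    "AE \<theta> in lborel. \<theta> \<in> {0..2*pi} \<longrightarrow> (\<forall>k\<ge>1::nat. c0 \<le> (\<Sum>n. defect (a n) (rcis (1 - 1 / 2 ^ k) \<theta>)) \<longrightarrow>
       ennreal (c * (1 / 2 ^ k) powr - s)
         \<le> (\<integral>\<^sup>+t\<in>{0<..1/2}. ennreal (D (rcis (1 - t) \<theta>) powr p * t powr \<alpha>) \<partial>lborel))"
proof -
  let ?B = "blaschke_product a"
  define G where "G k \<theta> = (\<Sum>n. defect (a n) (rcis (1 - 1 / 2 ^ k) \<theta>))" for k :: nat and \<theta>
  define \<delta> where "\<delta> = (1 - exp (- c0 / 2)) / 2"
  have \<delta>: "0 < \<delta>" using c0 by (simp add: \<delta>_def)
  obtain c where c: "0 < c" and energy: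
    "\<And>h u T. h \<in> borel_measurable borel \<Longrightarrow> 0 < u \<Longrightarrow> u \<le> T \<Longrightarrow>
       (\<And>t. t \<in> {u..T} \<Longrightarrow> 0 \<le> h t \<and> h t \<le> 2 / t) \<Longrightarrow>
       ennreal \<delta> \<le> (\<integral>\<^sup>+t\<in>{u..T}. ennreal (h t) \<partial>lborel) \<Longrightarrow>
       ennreal (c * T powr - s) \<le> (\<integral>\<^sup>+t\<in>{u..T}. ennreal (h t powr p * t powr \<alpha>) \<partial>lborel)"
    using energy_ge_of_total_variation_ge[OF p s[unfolded s_def] \<delta>] unfolding s_def by blast
  have hol: "?B holomorphic_on unit_disc" by (rule holomorphic_blaschke_product[OF a])
  have pow: "0 < (1::real) / 2 ^ k" "(1::real) / 2 ^ k \<le> 1" for k :: nat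
    by (simp_all add: divide_le_eq)
  have in_disc: "cmod (rcis (1 - t) \<theta>) < 1" if "0 < t" "t \<le> 1" for t \<theta>
    using that by simp
  have "AE \<theta> in lborel. \<theta> \<in> {0..2*pi} \<longrightarrow> liminf (\<lambda>k. ennreal (G k \<theta>)) = 0"
    unfolding G_def
  proof (rule AE_liminf_suminf_defect_eq_0[OF a])
    have "(\<lambda>k. 1 - (1/2::real) ^ k) \<longlonglongrightarrow> 1 - 0"
      by (intro tendsto_intros LIMSEQ_realpow_zero) auto
    then show "(\<lambda>k. 1 - 1 / (2::real) ^ k) \<longlonglongrightarrow> 1" by (simp add: power_one_over)
  qed (use pow in auto)
  then have "AE \<theta> in lborel. \<theta> \<in> {0..2*pi} \<longrightarrow> (\<forall>k\<ge>1::nat. c0 \<le> G k \<theta> \<longrightarrow>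
       ennreal (c * (1 / 2 ^ k) powr - s)
         \<le> (\<integral>\<^sup>+t\<in>{0<..1/2}. ennreal (D (rcis (1 - t) \<theta>) powr p * t powr \<alpha>) \<partial>lborel))"
  proof (eventually_elim, intro impI allI)
    fix \<theta> and k :: nat
    assume "\<theta> \<in> {0..2*pi} \<longrightarrow> liminf (\<lambda>k. ennreal (G k \<theta>)) = 0" "\<theta> \<in> {0..2*pi}"
      and k: "1 \<le> k" and Gk: "c0 \<le> G k \<theta>"
    then have "liminf (\<lambda>k. ennreal (G k \<theta>)) < ennreal \<delta>" using \<delta> by simp
    (* Arbitrarily close to the boundary the Blaschke product is nearly unimodular. *)
    then have "(INF j\<in>{k..}. ennreal (G j \<theta>)) < ennreal \<delta>"
      using Inf_lower2 unfolding liminf_SUP_INF by (meson SUP_upper UNIV_I le_less_trans)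
    then obtain j where j: "k \<le> j" "G j \<theta> < \<delta>"
      unfolding INF_less_iff by (metis atLeast_iff ennreal_leI not_le)
    define u where "u = (1::real) / 2 ^ j"
    define T where "T = (1::real) / 2 ^ k"
    have "(2::real) ^ 1 \<le> 2 ^ k" using k by (intro power_increasing) auto
    then have uT: "0 < u" "u \<le> T" "T \<le> 1/2"
      using j(1) by (auto simp: u_def T_def field_simps intro!: power_increasing)
    have "1 - \<delta> \<le> (cmod (?B (rcis (1 - u) \<theta>)))\<^sup>2"
      using norm_blaschke_product_sq_ge[OF a in_disc[of u \<theta>]] uT j(2) by (simp add: G_def u_def)
    also have "\<dots> \<le> cmod (?B (rcis (1 - u) \<theta>))"
      using norm_blaschke_product_le_1[OF a in_disc[of u \<theta>]] uT
      by (simp add: power2_eq_square mult_left_le_one_le)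
    finally have near: "1 - \<delta> \<le> cmod (?B (rcis (1 - u) \<theta>))" .
    have "(cmod (?B (rcis (1 - T) \<theta>)))\<^sup>2 \<le> exp (- G k \<theta>)"
      using norm_blaschke_product_sq_le[OF a in_disc[of T \<theta>]] uT by (simp add: G_def T_def)
    also have "\<dots> \<le> exp (- c0)" using Gk by simp
    also have "\<dots> = (exp (- c0 / 2))\<^sup>2" by (simp flip: exp_double)
    finally have "cmod (?B (rcis (1 - T) \<theta>)) \<le> exp (- c0 / 2)"
      by (rule power2_le_imp_le) simp
    then have "\<delta> \<le> cmod (?B (rcis (1 - u) \<theta>)) - cmod (?B (rcis (1 - T) \<theta>))"
      using near unfolding \<delta>_def by (simp add: field_simps)
    also have "\<dots> \<le> cmod (?B (rcis (1 - u) \<theta>) - ?B (rcis (1 - T) \<theta>))"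
      by (rule norm_triangle_ineq2)
    finally have "ennreal \<delta> \<le> ennreal (cmod (?B (rcis (1 - u) \<theta>) - ?B (rcis (1 - T) \<theta>)))"
      by (rule ennreal_leI)
    also have "\<dots> \<le> (\<integral>\<^sup>+t\<in>{u..T}. ennreal (cmod (deriv ?B (rcis (1 - t) \<theta>))) \<partial>lborel)"
      using uT by (intro norm_diff_le_nn_integral_deriv hol) auto
    also have "\<dots> = (\<integral>\<^sup>+t\<in>{u..T}. ennreal (D (rcis (1 - t) \<theta>)) \<partial>lborel)"
      using uT by (intro nn_integral_cong) (auto simp: indicator_def intro!: arg_cong[where f = ennreal] D[symmetric])
    finally have var: "ennreal \<delta> \<le> (\<integral>\<^sup>+t\<in>{u..T}. ennreal (D (rcis (1 - t) \<theta>)) \<partial>lborel)" .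
    have "ennreal (c * T powr - s) \<le> (\<integral>\<^sup>+t\<in>{u..T}. ennreal (D (rcis (1 - t) \<theta>) powr p * t powr \<alpha>) \<partial>lborel)"
    proof (rule energy[OF _ uT(1,2) _ var])
      fix t assume "t \<in> {u..T}"
      then have t: "0 < t" "t \<le> 1" using uT by auto
      show "0 \<le> D (rcis (1 - t) \<theta>) \<and> D (rcis (1 - t) \<theta>) \<le> 2 / t"
        using norm_deriv_le_of_bounded[OF hol norm_blaschke_product_le_1[OF a] in_disc[OF t]] D[OF in_disc[OF t]] t
        by simp
    qed simp
    also have "\<dots> \<le> (\<integral>\<^sup>+t\<in>{0<..1/2}. ennreal (D (rcis (1 - t) \<theta>) powr p * t powr \<alpha>) \<partial>lborel)"
      using uT by (intro nn_integral_mono mult_left_mono) (auto simp: indicator_def)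
    finally show "ennreal (c * (1 / 2 ^ k) powr - s)
         \<le> (\<integral>\<^sup>+t\<in>{0<..1/2}. ennreal (D (rcis (1 - t) \<theta>) powr p * t powr \<alpha>) \<partial>lborel)"
      by (simp add: T_def)
  qed
  with c show thesis unfolding G_def by (rule that)
qed

text \<open>
  Only heights up to \<open>1/2\<close> are kept, so that the factor \<open>r\<close> from polar coordinates is at least \<open>1/2\<close>.
\<close>
lemma nn_integral_radial_energy_le:
  fixes D :: "complex \<Rightarrow> real"
  assumes [measurable]: "D \<in> borel_measurable borel"
  shows "(\<integral>\<^sup>+\<theta>\<in>{0..2*pi}. \<integral>\<^sup>+t\<in>{0<..1/2}. ennreal (D (rcis (1 - t) \<theta>) powr p * t powr \<alpha>) \<partial>lborel \<partial>lborel)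
       \<le> 10 * (\<integral>\<^sup>+z\<in>unit_disc. ennreal (D z powr p * (1 - cmod z) powr \<alpha>) \<partial>lborel)"
proof -
  define f where "f z = D z powr p * (1 - cmod z) powr \<alpha> * indicator unit_disc z" for z
  have [measurable]: "unit_disc \<in> sets borel" by simp
  have [measurable]: "f \<in> borel_measurable borel" unfolding f_def by measurable
  have inner: "(\<integral>\<^sup>+t\<in>{0<..1/2}. ennreal (D (rcis (1 - t) \<theta>) powr p * t powr \<alpha>) \<partial>lborel)
      \<le> 2 * (\<integral>\<^sup>+r\<in>{0<..}. ennreal (r * f (rcis r \<theta>)) \<partial>lborel)" for \<theta>
  proof -
    have "(\<integral>\<^sup>+t\<in>{0<..1/2}. ennreal (D (rcis (1 - t) \<theta>) powr p * t powr \<alpha>) \<partial>lborel)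
        \<le> (\<integral>\<^sup>+t. 2 * (ennreal ((1 - t) * f (rcis (1 - t) \<theta>)) * indicator {0<..} (1 - t)) \<partial>lborel)"
    proof (rule nn_integral_mono)
      fix t :: real
      show "ennreal (D (rcis (1 - t) \<theta>) powr p * t powr \<alpha>) * indicator {0<..1/2} t
          \<le> 2 * (ennreal ((1 - t) * f (rcis (1 - t) \<theta>)) * indicator {0<..} (1 - t))"
      proof (cases "t \<in> {0<..1/2}")
        case True
        then have t: "0 < t" "t \<le> 1/2" by auto
        define y where "y = D (rcis (1 - t) \<theta>) powr p * t powr \<alpha>"
        have f: "f (rcis (1 - t) \<theta>) = y" using t by (simp add: f_def y_def)
        have y: "0 \<le> y" by (simp add: y_def)
        have "1 * y \<le> (2 * (1 - t)) * y" using t y by (intro mult_right_mono) auto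
        then have "ennreal y \<le> ennreal (2 * ((1 - t) * y))" by (intro ennreal_leI) (simp only: mult.assoc mult_1)
        also have "\<dots> = 2 * ennreal ((1 - t) * y)" by (simp add: ennreal_mult')
        finally show ?thesis using t f by (simp add: y_def)
      qed simp
    qed
    also have "\<dots> = 2 * (\<integral>\<^sup>+t. ennreal ((1 - t) * f (rcis (1 - t) \<theta>)) * indicator {0<..} (1 - t) \<partial>lborel)"
      by (rule nn_integral_cmult) simp
    also have "(\<integral>\<^sup>+t. ennreal ((1 - t) * f (rcis (1 - t) \<theta>)) * indicator {0<..} (1 - t) \<partial>lborel)
        = (\<integral>\<^sup>+r\<in>{0<..}. ennreal (r * f (rcis r \<theta>)) \<partial>lborel)"
      using nn_integral_real_affine[of "\<lambda>r. ennreal (r * f (rcis r \<theta>)) * indicator {0<..} r" "-1" 1]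
      by simp
    finally show ?thesis .
  qed
  have "(\<integral>\<^sup>+\<theta>\<in>{0..2*pi}. \<integral>\<^sup>+t\<in>{0<..1/2}. ennreal (D (rcis (1 - t) \<theta>) powr p * t powr \<alpha>) \<partial>lborel \<partial>lborel)
      \<le> (\<integral>\<^sup>+\<theta>. 2 * ((\<integral>\<^sup>+r\<in>{0<..}. ennreal (r * f (rcis r \<theta>)) \<partial>lborel) * indicator {0..2*pi} \<theta>) \<partial>lborel)"
    by (rule nn_integral_mono) (simp add: inner mult_right_mono flip: mult.assoc)
  also have "\<dots> = 2 * (\<integral>\<^sup>+\<theta>\<in>{0..2*pi}. \<integral>\<^sup>+r\<in>{0<..}. ennreal (r * f (rcis r \<theta>)) \<partial>lborel \<partial>lborel)"
    by (rule nn_integral_cmult) simp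
  also have "\<dots> \<le> 2 * (5 * (\<integral>\<^sup>+z. ennreal (f z) \<partial>lborel))"
    by (intro mult_left_mono nn_integral_polar_le) auto
  also have "\<dots> = 10 * (\<integral>\<^sup>+z\<in>unit_disc. ennreal (D z powr p * (1 - cmod z) powr \<alpha>) \<partial>lborel)"
  proof -
    have "ennreal (f z) = ennreal (D z powr p * (1 - cmod z) powr \<alpha>) * indicator unit_disc z" for z
      by (simp add: f_def indicator_def)
    then show ?thesis by (simp flip: mult.assoc)
  qed
  finally show ?thesis .
qed

section \<open>From the stopping time to the zeros\<close>

text \<open>
  For \<open>z\<close> in the box of side \<open>d = 1 - |a|\<close> at \<open>a/|a|\<close>, all of \<open>1 - |a|\<close>, \<open>1 - |z|\<close> and the difference of
  the arguments are at most \<open>d\<close>, so \<open>|1 - cnj a z| \<le> 3 d\<close>.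
\<close>
lemma defect_in_carleson_box:
  assumes a: "cmod a < 1" "a = rcis (cmod a) \<phi>" and t: "0 < t" "t \<le> 1 - cmod a" "t \<le> 1"
    and \<theta>: "\<bar>\<theta> - \<phi>\<bar> \<le> 1 - cmod a"
  shows "t / (9 * (1 - cmod a)) \<le> defect a (rcis (1 - t) \<theta>)"
proof -
  define d where "d = 1 - cmod a"
  have d: "0 < d" "d \<le> 1" using a by (auto simp: d_def)
  define \<rho> where "\<rho> = (1 - d) * (1 - t)"
  have "\<rho> \<le> 1" unfolding \<rho>_def using d t by (intro mult_le_one) auto
  moreover have "0 \<le> \<rho>" unfolding \<rho>_def using d t by (intro mult_nonneg_nonneg) auto
  moreover have "1 - \<rho> \<le> d + t" using d t by (simp add: \<rho>_def algebra_simps)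
  ultimately have \<rho>: "0 \<le> \<rho>" "\<rho> \<le> 1" "1 - \<rho> \<le> d + t" by auto
  have "cnj a * rcis (1 - t) \<theta> = of_real \<rho> * cis (\<theta> - \<phi>)"
    by (subst a(2)) (simp add: rcis_def \<rho>_def d_def cis_cnj diff_conv_add_uminus
        flip: cis_mult del: add_uminus_conv_diff)
  then have "cmod (1 - cnj a * rcis (1 - t) \<theta>) = cmod (of_real (1 - \<rho>) + of_real \<rho> * (1 - cis (\<theta> - \<phi>)))"
    by (simp add: algebra_simps)
  also have "\<dots> \<le> (1 - \<rho>) + \<rho> * cmod (1 - cis (\<theta> - \<phi>))"
    by (rule order_trans[OF norm_triangle_ineq]) (use \<rho> in \<open>simp add: norm_mult del: of_real_diff\<close>)
  also have "cmod (1 - cis (\<theta> - \<phi>)) \<le> d"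
  proof -
    have "cmod (1 - cis (\<theta> - \<phi>)) = 2 * \<bar>sin ((\<theta> - \<phi>) / 2)\<bar>"
      using dist_exp_i_1[of "\<theta> - \<phi>"] by (simp add: cis_conv_exp norm_minus_commute)
    also have "\<dots> \<le> 2 * \<bar>(\<theta> - \<phi>) / 2\<bar>" by (intro mult_left_mono abs_sin_x_le_abs_x) auto
    finally show ?thesis using \<theta> by (simp add: d_def)
  qed
  also have "(1 - \<rho>) + \<rho> * d \<le> (d + t) + 1 * d"
    using \<rho> d by (intro add_mono mult_right_mono) auto
  finally have "cmod (1 - cnj a * rcis (1 - t) \<theta>) \<le> 3 * d"
    using \<rho> t by (simp add: d_def mult_left_mono)
  then have denom: "(cmod (1 - cnj a * rcis (1 - t) \<theta>))\<^sup>2 \<le> (3 * d)\<^sup>2"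
    by (intro power_mono) auto
  have one_minus_sq: "1 - x \<le> 1 - x\<^sup>2" if "0 \<le> x" "x \<le> 1" for x :: real
    using that by (simp add: power2_eq_square mult_left_le_one_le)
  have "1 - cnj a * rcis (1 - t) \<theta> \<noteq> 0"
    using t by (intro one_minus_cnj_mult_nonzero a) auto
  then have "d * t / (3 * d)\<^sup>2 \<le> defect a (rcis (1 - t) \<theta>)"
    unfolding defect_def
    using one_minus_sq[of "cmod a"] one_minus_sq[of "1 - t"] t d
    by (intro frac_le mult_mono denom) (auto simp: d_def)
  moreover have "d * t / (3 * d)\<^sup>2 = t / (9 * d)" using d by (simp add: power2_eq_square)
  ultimately show ?thesis by (simp add: d_def)
qed

text \<open>
  The lower bound for the \<open>n\<close>-th summand rests on
  \<open>\<mu>\<^sup>1\<^sup>-\<^sup>s \<le> \<tau>\<^sup>1\<^sup>-\<^sup>s + \<mu> \<tau>\<^sup>-\<^sup>s\<close>, which holds for all positive \<open>\<mu>\<close> and \<open>\<tau>\<close>: the first term dominates if \<open>\<tau> \<ge> \<mu>\<close>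
  and the second if \<open>\<tau> \<le> \<mu>\<close>. Integrated over an arc of length \<open>d\<close> it gives
  \<open>d \<mu>\<^sup>1\<^sup>-\<^sup>s \<le> \<integral> \<tau>\<^sup>1\<^sup>-\<^sup>s + \<mu> K\<close>, and \<open>\<mu>\<close> is taken so that the last term is half of the left-hand side,
  that is \<open>\<mu>\<^sup>s = d / (2 K)\<close>.
\<close>
lemma summable_of_stopping_time:
  fixes \<tau> :: "real \<Rightarrow> real"
  assumes a: "blaschke_sequence a" and s: "0 < s" "s < 1"
    and [measurable]: "\<tau> \<in> borel_measurable borel" and \<tau>: "\<And>\<theta>. 0 < \<tau> \<theta>" "\<And>\<theta>. \<tau> \<theta> \<le> 1"
    and fin: "(\<integral>\<^sup>+\<theta>\<in>{0..2*pi}. ennreal (\<tau> \<theta> powr - s) \<partial>lborel) < \<infinity>"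
    and stop: "AE \<theta> in lborel. \<theta> \<in> {0..2*pi} \<longrightarrow> (\<Sum>n. defect (a n) (rcis (1 - \<tau> \<theta> / 2) \<theta>)) \<le> 1"
    and near: "AE \<theta> in lborel. \<theta> \<in> {0..2*pi} \<longrightarrow>
       (\<forall>n. \<bar>\<theta> - Arg2pi (a n)\<bar> \<le> 1 - cmod (a n) \<longrightarrow> \<tau> \<theta> \<le> 1 - cmod (a n))"
  shows "summable (\<lambda>n. (1 - cmod (a n)) powr ((1 - s) / s))"
proof -
  define d where "d n = 1 - cmod (a n)" for n
  define \<phi> where "\<phi> n = Arg2pi (a n)" for n
  have d: "0 < d n" "d n < 1" and a1: "0 < cmod (a n)" "cmod (a n) < 1" for n
    using a by (auto simp: d_def blaschke_sequence_def)
  have polar: "a n = rcis (cmod (a n)) (\<phi> n)" for n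
    using Arg2pi_eq[of "a n"] by (simp add: rcis_def cis_conv_exp \<phi>_def)
  have \<phi>: "0 \<le> \<phi> n" "\<phi> n < 2 * pi" for n
    by (simp_all add: \<phi>_def Arg2pi_ge_0 Arg2pi_lt_2pi)
  (* One of the two arcs of length d n adjacent to the argument lies in the parameter interval. *)
  define I where "I n = (if \<phi> n \<le> pi then {\<phi> n..\<phi> n + d n} else {\<phi> n - d n..\<phi> n})" for n
  have I_sub: "I n \<subseteq> {0..2*pi}" for n
    using \<phi>[of n] d[of n] pi_gt3 by (auto simp: I_def)
  have I_near: "\<bar>\<theta> - \<phi> n\<bar> \<le> d n" if "\<theta> \<in> I n" for \<theta> n
    using that by (auto simp: I_def split: if_splits)
  have [measurable]: "I n \<in> sets borel" for n by (simp add: I_def)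
  have I_meas: "emeasure lborel (I n) = ennreal (d n)" for n
    using d(1)[of n] by (simp add: I_def)
  (* Adding 1 keeps K positive without a separate argument. *)
  define K where "K = enn2real (\<integral>\<^sup>+\<theta>\<in>{0..2*pi}. ennreal (\<tau> \<theta> powr - s) \<partial>lborel) + 1"
  have K: "0 < K" by (simp add: K_def add_nonneg_pos)
  have K_ge: "(\<integral>\<^sup>+\<theta>\<in>{0..2*pi}. ennreal (\<tau> \<theta> powr - s) \<partial>lborel) \<le> ennreal K"
  proof -
    have "(\<integral>\<^sup>+\<theta>\<in>{0..2*pi}. ennreal (\<tau> \<theta> powr - s) \<partial>lborel)
        = ennreal (enn2real (\<integral>\<^sup>+\<theta>\<in>{0..2*pi}. ennreal (\<tau> \<theta> powr - s) \<partial>lborel))"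
      using fin by simp
    also have "\<dots> \<le> ennreal K" unfolding K_def by (intro ennreal_leI) simp
    finally show ?thesis .
  qed
  define x where "x n = (d n / (2 * K)) powr ((1 - s) / s) / 36" for n
  have lower: "ennreal (x n) \<le> (\<integral>\<^sup>+\<theta>. ennreal (\<tau> \<theta> powr - s) * ennreal (defect (a n) (rcis (1 - \<tau> \<theta> / 2) \<theta>))
       * indicator {0..2*pi} \<theta> \<partial>lborel)" for n
  proof -
    define \<mu> where "\<mu> = (d n / (2 * K)) powr (1 / s)"
    have \<mu>: "0 < \<mu>" using d(1)[of n] K by (simp add: \<mu>_def)
    have \<mu>_s: "\<mu> powr s = d n / (2 * K)" using s d(1)[of n] K by (simp add: \<mu>_def powr_powr)
    have \<mu>_beta: "\<mu> powr (1 - s) = (d n / (2 * K)) powr ((1 - s) / s)"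
      by (simp add: \<mu>_def powr_powr)
    have \<mu>_K: "\<mu> * K = \<mu> powr (1 - s) * d n / 2"
    proof -
      have "\<mu> = \<mu> powr (1 - s) * \<mu> powr s" using \<mu> by (simp flip: powr_add)
      also have "\<dots> = \<mu> powr (1 - s) * d n / (2 * K)" by (simp add: \<mu>_s)
      finally show ?thesis using K by (simp add: field_simps)
    qed
    have pt: "\<mu> powr (1 - s) \<le> \<tau> \<theta> powr (1 - s) + \<mu> * \<tau> \<theta> powr - s" for \<theta>
    proof (cases "\<mu> \<le> \<tau> \<theta>")
      case True
      then have "\<mu> powr (1 - s) \<le> \<tau> \<theta> powr (1 - s)" using \<mu> s by (intro powr_mono2) auto
      then show ?thesis using \<mu> by (simp add: add_increasing2)
    next
      case False
      have "\<mu> powr (1 - s) = \<mu> * \<mu> powr - s" using \<mu> by (simp add: powr_diff powr_minus divide_inverse)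
      also have "\<dots> \<le> \<mu> * \<tau> \<theta> powr - s"
        using \<mu> s False \<tau>(1)[of \<theta>] by (intro mult_left_mono powr_mono2') auto
      finally show ?thesis by (simp add: add_increasing)
    qed
    define J where "J = (\<integral>\<^sup>+\<theta>\<in>I n. ennreal (\<tau> \<theta> powr (1 - s)) \<partial>lborel)"
    have "ennreal (\<mu> powr (1 - s) * d n) = (\<integral>\<^sup>+\<theta>. ennreal (\<mu> powr (1 - s)) * indicator (I n) \<theta> \<partial>lborel)"
      by (simp add: nn_integral_cmult_indicator I_meas ennreal_mult')
    also have "\<dots> \<le> (\<integral>\<^sup>+\<theta>. ennreal (\<tau> \<theta> powr (1 - s)) * indicator (I n) \<theta>
        + ennreal \<mu> * (ennreal (\<tau> \<theta> powr - s) * indicator {0..2*pi} \<theta>) \<partial>lborel)"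
    proof (rule nn_integral_mono)
      fix \<theta>
      show "ennreal (\<mu> powr (1 - s)) * indicator (I n) \<theta> \<le> ennreal (\<tau> \<theta> powr (1 - s)) * indicator (I n) \<theta>
        + ennreal \<mu> * (ennreal (\<tau> \<theta> powr - s) * indicator {0..2*pi} \<theta>)"
      proof (cases "\<theta> \<in> I n")
        case True
        have "ennreal (\<mu> powr (1 - s)) \<le> ennreal (\<tau> \<theta> powr (1 - s)) + ennreal (\<mu> * \<tau> \<theta> powr - s)"
          using pt[of \<theta>] \<mu> by (simp add: ennreal_leI flip: ennreal_plus)
        then show ?thesis using True I_sub[of n] \<mu> by (auto simp: ennreal_mult')
      qed simp
    qed
    also have "\<dots> = J + ennreal \<mu> * (\<integral>\<^sup>+\<theta>\<in>{0..2*pi}. ennreal (\<tau> \<theta> powr - s) \<partial>lborel)"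
      unfolding J_def by (subst nn_integral_add) (simp_all add: nn_integral_cmult)
    also have "\<dots> \<le> J + ennreal \<mu> * ennreal K"
      by (intro add_left_mono mult_left_mono K_ge) simp
    also have "\<dots> = J + ennreal (\<mu> powr (1 - s) * d n / 2)"
      using \<mu> by (simp add: \<mu>_K flip: ennreal_mult')
    finally have "ennreal (\<mu> powr (1 - s) * d n) \<le> J + ennreal (\<mu> powr (1 - s) * d n / 2)" .
    then have J: "ennreal (\<mu> powr (1 - s) * d n / 2) \<le> J"
    proof (cases J)
      case (real j)
      assume "ennreal (\<mu> powr (1 - s) * d n) \<le> J + ennreal (\<mu> powr (1 - s) * d n / 2)"
      then have "ennreal (\<mu> powr (1 - s) * d n) \<le> ennreal (j + \<mu> powr (1 - s) * d n / 2)"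
        using real d(1)[of n] by simp
      then have "\<mu> powr (1 - s) * d n \<le> j + \<mu> powr (1 - s) * d n / 2"
        using real d(1)[of n] by (subst (asm) ennreal_le_iff) auto
      then have "\<mu> powr (1 - s) * d n / 2 \<le> j" by linarith
      then show ?thesis using real by (simp add: ennreal_leI)
    qed simp
    have "x n = 1 / (18 * d n) * (\<mu> powr (1 - s) * d n / 2)"
      using d(1)[of n] by (simp add: x_def \<mu>_beta)
    then have "ennreal (x n) = ennreal (1 / (18 * d n)) * ennreal (\<mu> powr (1 - s) * d n / 2)"
      using d(1)[of n] by (simp only:) (rule ennreal_mult', simp)
    also have "\<dots> \<le> ennreal (1 / (18 * d n)) * J" by (intro mult_left_mono J) simp
    also have "\<dots> = (\<integral>\<^sup>+\<theta>. ennreal (1 / (18 * d n)) * (ennreal (\<tau> \<theta> powr (1 - s)) * indicator (I n) \<theta>) \<partial>lborel)"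
      unfolding J_def by (rule nn_integral_cmult[symmetric]) simp
    also have "\<dots> \<le> (\<integral>\<^sup>+\<theta>. ennreal (\<tau> \<theta> powr - s) * ennreal (defect (a n) (rcis (1 - \<tau> \<theta> / 2) \<theta>))
       * indicator {0..2*pi} \<theta> \<partial>lborel)"
    proof (rule nn_integral_mono_AE, use near in eventually_elim)
      fix \<theta>
      assume near: "\<theta> \<in> {0..2*pi} \<longrightarrow> (\<forall>n. \<bar>\<theta> - Arg2pi (a n)\<bar> \<le> 1 - cmod (a n) \<longrightarrow> \<tau> \<theta> \<le> 1 - cmod (a n))"
      show "ennreal (1 / (18 * d n)) * (ennreal (\<tau> \<theta> powr (1 - s)) * indicator (I n) \<theta>)
        \<le> ennreal (\<tau> \<theta> powr - s) * ennreal (defect (a n) (rcis (1 - \<tau> \<theta> / 2) \<theta>)) * indicator {0..2*pi} \<theta>"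
      proof (cases "\<theta> \<in> I n")
        case True
        then have \<theta>: "\<theta> \<in> {0..2*pi}" using I_sub by blast
        have "\<tau> \<theta> \<le> d n" using near \<theta> I_near[OF True] by (simp add: d_def \<phi>_def)
        then have box: "\<tau> \<theta> / 2 / (9 * d n) \<le> defect (a n) (rcis (1 - \<tau> \<theta> / 2) \<theta>)"
          unfolding d_def using \<tau>[of \<theta>] I_near[OF True]
          by (intro defect_in_carleson_box[OF a1(2) polar]) (auto simp: d_def)
        have "1 / (18 * d n) * \<tau> \<theta> powr (1 - s) = \<tau> \<theta> powr - s * (\<tau> \<theta> / 2 / (9 * d n))"
          using \<tau>(1)[of \<theta>] d(1)[of n] by (simp add: powr_diff powr_minus field_simps)
        also have "\<dots> \<le> \<tau> \<theta> powr - s * defect (a n) (rcis (1 - \<tau> \<theta> / 2) \<theta>)"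
          by (intro mult_left_mono box) simp
        finally have "ennreal (1 / (18 * d n) * \<tau> \<theta> powr (1 - s))
            \<le> ennreal (\<tau> \<theta> powr - s * defect (a n) (rcis (1 - \<tau> \<theta> / 2) \<theta>))"
          by (rule ennreal_leI)
        moreover have "0 \<le> 1 / (18 * d n)" using d(1)[of n] by simp
        ultimately show ?thesis using True \<theta>
          by (simp add: ennreal_mult' del: times_divide_eq_left)
      qed simp
    qed
    finally show ?thesis .
  qed
  have "(\<Sum>n. ennreal (x n)) \<le> (\<Sum>n. \<integral>\<^sup>+\<theta>. ennreal (\<tau> \<theta> powr - s) * ennreal (defect (a n) (rcis (1 - \<tau> \<theta> / 2) \<theta>))
       * indicator {0..2*pi} \<theta> \<partial>lborel)"
    by (intro suminf_le lower) auto
  also have "\<dots> = (\<integral>\<^sup>+\<theta>. (\<Sum>n. ennreal (\<tau> \<theta> powr - s) * ennreal (defect (a n) (rcis (1 - \<tau> \<theta> / 2) \<theta>))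
       * indicator {0..2*pi} \<theta>) \<partial>lborel)"
    by (rule nn_integral_suminf[symmetric]) simp
  also have "\<dots> \<le> (\<integral>\<^sup>+\<theta>\<in>{0..2*pi}. ennreal (\<tau> \<theta> powr - s) \<partial>lborel)"
  proof (rule nn_integral_mono_AE, use stop in eventually_elim)
    fix \<theta> assume *: "\<theta> \<in> {0..2*pi} \<longrightarrow> (\<Sum>n. defect (a n) (rcis (1 - \<tau> \<theta> / 2) \<theta>)) \<le> 1"
    show "(\<Sum>n. ennreal (\<tau> \<theta> powr - s) * ennreal (defect (a n) (rcis (1 - \<tau> \<theta> / 2) \<theta>)) * indicator {0..2*pi} \<theta>)
      \<le> ennreal (\<tau> \<theta> powr - s) * indicator {0..2*pi} \<theta>"
    proof (cases "\<theta> \<in> {0..2*pi}")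
      case True
      have disc: "cmod (rcis (1 - \<tau> \<theta> / 2) \<theta>) < 1" using \<tau>[of \<theta>] by simp
      have "(\<Sum>n. ennreal (defect (a n) (rcis (1 - \<tau> \<theta> / 2) \<theta>))) = ennreal (\<Sum>n. defect (a n) (rcis (1 - \<tau> \<theta> / 2) \<theta>))"
        using a1(2) disc by (intro suminf_ennreal2 defect_nonneg summable_defect[OF a]) auto
      also have "\<dots> \<le> ennreal 1" using * True by (intro ennreal_leI) simp
      finally have "ennreal (\<tau> \<theta> powr - s) * (\<Sum>n. ennreal (defect (a n) (rcis (1 - \<tau> \<theta> / 2) \<theta>)))
          \<le> ennreal (\<tau> \<theta> powr - s) * 1" by (intro mult_left_mono) auto
      then show ?thesis using True by simp
    qed simp
  qed
  finally have "(\<Sum>n. ennreal (x n)) \<noteq> top" using fin by (auto simp: top_unique)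
  then have "summable x"
    by (intro summable_suminf_not_top) (simp_all add: x_def)
  then have "summable (\<lambda>n. (36 * (2 * K) powr ((1 - s) / s)) * x n)" by (rule summable_mult)
  moreover have "(36 * (2 * K) powr ((1 - s) / s)) * x n = d n powr ((1 - s) / s)" for n
    using d(1)[of n] K by (simp add: x_def powr_divide)
  ultimately show ?thesis by (simp add: d_def)
qed

section \<open>Derivatives of Blaschke products in weighted Bergman spaces\<close>

theorem theorem2:
  fixes a :: "nat \<Rightarrow> complex" and p \<alpha> :: real
  assumes "blaschke_sequence a"
    and "\<alpha> > -1"
    and "3 / 2 + \<alpha> < p"
    and "p < 2 + \<alpha>"
    and "deriv (blaschke_product a) \<in> bergman_space p \<alpha>"
  shows "summable (\<lambda>n. (1 - cmod (a n)) powr ((2 - p + \<alpha>) / (p - 1 - \<alpha>)))"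
proof -
  note a = assms(1)
  define s where "s = p - 1 - \<alpha>"
  have s: "0 < s" "s < 1" and p: "0 < p" using assms(2-4) by (auto simp: s_def)
  have a1: "0 < cmod (a n)" "cmod (a n) < 1" for n
    using a by (auto simp: blaschke_sequence_def)
  define D where "D z = cmod (deriv (blaschke_product a) z) * indicator unit_disc z" for z
  have [measurable]: "D \<in> borel_measurable borel"
  proof -
    have "deriv (blaschke_product a) holomorphic_on unit_disc"
      using assms(5) by (simp add: bergman_space_def analytic_imp_holomorphic)
    then have "continuous_on unit_disc (\<lambda>z. cmod (deriv (blaschke_product a) z))"
      by (intro continuous_intros holomorphic_on_imp_continuous_on)
    then have "(\<lambda>z. indicator unit_disc z *\<^sub>R cmod (deriv (blaschke_product a) z)) \<in> borel_measurable borel"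
      by (intro borel_measurable_continuous_on_indicator) auto
    then show ?thesis by (simp add: D_def[abs_def] mult.commute)
  qed
  have D: "D z = cmod (deriv (blaschke_product a) z)" if "cmod z < 1" for z
    using that by (simp add: D_def)
  define A where "A \<theta> = (\<integral>\<^sup>+t\<in>{0<..1/2}. ennreal (D (rcis (1 - t) \<theta>) powr p * t powr \<alpha>) \<partial>lborel)" for \<theta>
  have [measurable]: "A \<in> borel_measurable borel" unfolding A_def by measurable
  have A_fin: "(\<integral>\<^sup>+\<theta>\<in>{0..2*pi}. A \<theta> \<partial>lborel) < \<infinity>"
  proof -
    have "(\<integral>\<^sup>+z\<in>unit_disc. ennreal (D z powr p * (1 - cmod z) powr \<alpha>) \<partial>lborel)
        = (\<integral>\<^sup>+z\<in>unit_disc. ennreal (cmod (deriv (blaschke_product a) z) powr p * (1 - cmod z) powr \<alpha>) \<partial>lborel)"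
      by (intro nn_integral_cong) (simp add: D_def indicator_def)
    also have "\<dots> < \<infinity>"
      using assms(5) by (auto simp: bergman_space_def bergman_norm_def Let_def less_top split: if_splits)
    finally have "10 * (\<integral>\<^sup>+z\<in>unit_disc. ennreal (D z powr p * (1 - cmod z) powr \<alpha>) \<partial>lborel) < \<infinity>"
      by (simp add: ennreal_mult_less_top)
    with nn_integral_radial_energy_le[of D p \<alpha>] show ?thesis
      unfolding A_def by (auto intro: le_less_trans)
  qed
  define G where "G k \<theta> = (\<Sum>n. defect (a n) (rcis (1 - 1 / 2 ^ k) \<theta>))" for k :: nat and \<theta>
  have [measurable]: "G k \<in> borel_measurable borel" for k unfolding G_def by measurable
  obtain c where c: "0 < c" and AE_A:
    "AE \<theta> in lborel. \<theta> \<in> {0..2*pi} \<longrightarrow> (\<forall>k\<ge>1::nat. 1/18 \<le> G k \<theta> \<longrightarrow> ennreal (c * (1 / 2 ^ k) powr - s) \<le> A \<theta>)"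
    using AE_radial_energy_ge[OF a p s(1)[unfolded s_def], of "1/18" D] D unfolding A_def G_def s_def by auto
  have "AE \<theta> in lborel. A \<theta> * indicator {0..2*pi} \<theta> \<noteq> \<infinity>"
    using A_fin by (intro nn_integral_noteq_infinite) auto
  then have AE_fin: "AE \<theta> in lborel. \<theta> \<in> {0..2*pi} \<longrightarrow> A \<theta> < \<infinity>"
    by eventually_elim (auto simp: less_top)
  (* The index 0 keeps the set nonempty; it stands for a radius on which no dyadic height k >= 1
     qualifies, and gives the height 1. *)
  define S where "S \<theta> = {k::nat. k = 0 \<or> 1/18 \<le> G k \<theta>}" for \<theta>
  define \<tau> :: "real \<Rightarrow> real" where "\<tau> \<theta> = (1 / 2) ^ Max (S \<theta>)" for \<theta>
  have [measurable]: "(\<lambda>\<theta>. Max (S \<theta>)) \<in> borel \<rightarrow>\<^sub>M count_space UNIV"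
    unfolding S_def by measurable
  have [measurable]: "\<tau> \<in> borel_measurable borel" unfolding \<tau>_def by measurable
  have \<tau>: "0 < \<tau> \<theta>" "\<tau> \<theta> \<le> 1" for \<theta> by (simp_all add: \<tau>_def power_le_one)
  have AE_S: "AE \<theta> in lborel. \<theta> \<in> {0..2*pi} \<longrightarrow> finite (S \<theta>) \<and> ennreal (\<tau> \<theta> powr - s) \<le> 1 + ennreal (1 / c) * A \<theta>"
    using AE_A AE_fin
  proof (eventually_elim, intro impI)
    fix \<theta>
    assume "\<theta> \<in> {0..2*pi} \<longrightarrow> (\<forall>k\<ge>1::nat. 1/18 \<le> G k \<theta> \<longrightarrow> ennreal (c * (1 / 2 ^ k) powr - s) \<le> A \<theta>)"
      "\<theta> \<in> {0..2*pi} \<longrightarrow> A \<theta> < \<infinity>" "\<theta> \<in> {0..2*pi}"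
    then have A: "\<And>k. k \<ge> 1 \<Longrightarrow> 1/18 \<le> G k \<theta> \<Longrightarrow> ennreal (c * (1 / 2 ^ k) powr - s) \<le> A \<theta>" "A \<theta> < \<infinity>"
      by auto
    define r where "r = enn2real (A \<theta>)"
    have r: "A \<theta> = ennreal r" "0 \<le> r" using A(2) by (simp_all add: r_def)
    have le: "((1 / 2) ^ k) powr - s \<le> 1 + r / c" if "k \<in> S \<theta>" for k
    proof (cases "k = 0")
      case False
      then have "c * (1 / 2 ^ k) powr - s \<le> r"
        using A(1)[of k] that r by (simp add: S_def)
      then show ?thesis using c by (simp add: field_simps)
    qed (use r c in auto)
    (* Growth of 2^(ks) rules out infinitely many levels. *)
    have "\<exists>m. \<forall>k\<ge>m. 1 + r / c < (2 powr s) ^ k"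
    proof -
      have "1 < 2 powr s" using s by simp
      then obtain m where m: "1 + r / c < (2 powr s) ^ m" using real_arch_pow by blast
      have "(2 powr s) ^ m \<le> (2 powr s) ^ k" if "m \<le> k" for k
        using that \<open>1 < 2 powr s\<close> by (intro power_increasing) auto
      then show ?thesis using m by (meson less_le_trans)
    qed
    then obtain m where m: "\<And>k. m \<le> k \<Longrightarrow> 1 + r / c < (2 powr s) ^ k" by blast
    have pw: "((1 / 2) ^ k) powr - s = (2 powr s) ^ k" for k :: nat
      by (simp add: powr_minus powr_power powr_powr power_one_over powr_divide flip: powr_realpow) (simp add: powr_powr mult.commute)
    have "S \<theta> \<subseteq> {..<m}" using le m by (force simp: pw not_le[symmetric])
    then have fin: "finite (S \<theta>)" by (rule finite_subset) simp
    have "Max (S \<theta>) \<in> S \<theta>" using fin by (intro Max_in) (auto simp: S_def)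
    from le[OF this] have "\<tau> \<theta> powr - s \<le> 1 + r / c" by (simp add: \<tau>_def)
    then have "ennreal (\<tau> \<theta> powr - s) \<le> ennreal (1 + 1 / c * r)" by (intro ennreal_leI) simp
    also have "\<dots> = 1 + ennreal (1 / c) * A \<theta>"
      using c r by (subst ennreal_plus) (auto simp: ennreal_mult'[symmetric])
    finally show "finite (S \<theta>) \<and> ennreal (\<tau> \<theta> powr - s) \<le> 1 + ennreal (1 / c) * A \<theta>"
      using fin by simp
  qed
  have exponent: "(1 - s) / s = (2 - p + \<alpha>) / (p - 1 - \<alpha>)" by (simp add: s_def)
  show ?thesis
    unfolding exponent[symmetric]
  proof (rule summable_of_stopping_time[OF a s _ \<tau>])
    show "(\<integral>\<^sup>+\<theta>\<in>{0..2*pi}. ennreal (\<tau> \<theta> powr - s) \<partial>lborel) < \<infinity>"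
    proof -
      have "(\<integral>\<^sup>+\<theta>\<in>{0..2*pi}. ennreal (\<tau> \<theta> powr - s) \<partial>lborel)
          \<le> (\<integral>\<^sup>+\<theta>. indicator {0..2*pi} \<theta> + ennreal (1 / c) * (A \<theta> * indicator {0..2*pi} \<theta>) \<partial>lborel)"
        by (rule nn_integral_mono_AE, use AE_S in eventually_elim) (auto simp: indicator_def)
      also have "\<dots> = ennreal (2 * pi) + ennreal (1 / c) * (\<integral>\<^sup>+\<theta>\<in>{0..2*pi}. A \<theta> \<partial>lborel)"
        by (subst nn_integral_add) (simp_all add: nn_integral_cmult)
      also have "\<dots> < \<infinity>" using A_fin by (simp add: ennreal_mult_less_top)
      finally show ?thesis .
    qed
    show "AE \<theta> in lborel. \<theta> \<in> {0..2*pi} \<longrightarrow> (\<Sum>n. defect (a n) (rcis (1 - \<tau> \<theta> / 2) \<theta>)) \<le> 1"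
      using AE_S
    proof (eventually_elim, intro impI)
      fix \<theta> assume "\<theta> \<in> {0..2*pi} \<longrightarrow> finite (S \<theta>) \<and> ennreal (\<tau> \<theta> powr - s) \<le> 1 + ennreal (1 / c) * A \<theta>"
        "\<theta> \<in> {0..2*pi}"
      then have "finite (S \<theta>)" by blast
      then have "Suc (Max (S \<theta>)) \<notin> S \<theta>" using Max_ge Suc_n_not_le_n by blast
      then have "G (Suc (Max (S \<theta>))) \<theta> < 1/18" by (simp add: S_def)
      then show "(\<Sum>n. defect (a n) (rcis (1 - \<tau> \<theta> / 2) \<theta>)) \<le> 1"
        by (simp add: G_def \<tau>_def power_one_over mult.commute)
    qed
    show "AE \<theta> in lborel. \<theta> \<in> {0..2*pi} \<longrightarrow>
       (\<forall>n. \<bar>\<theta> - Arg2pi (a n)\<bar> \<le> 1 - cmod (a n) \<longrightarrow> \<tau> \<theta> \<le> 1 - cmod (a n))"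
      using AE_S
    proof (eventually_elim, intro impI allI)
      fix \<theta> n assume "\<theta> \<in> {0..2*pi} \<longrightarrow> finite (S \<theta>) \<and> ennreal (\<tau> \<theta> powr - s) \<le> 1 + ennreal (1 / c) * A \<theta>"
        "\<theta> \<in> {0..2*pi}" and near: "\<bar>\<theta> - Arg2pi (a n)\<bar> \<le> 1 - cmod (a n)"
      then have fin: "finite (S \<theta>)" by blast
      define d where "d = 1 - cmod (a n)"
      have d: "0 < d" "d < 1" using a1[of n] by (auto simp: d_def)
      (* The largest dyadic height not exceeding d. It is more than d/2, so that the lower bound
         t / (9 d) for the defect is more than 1/18, the level in the stopping rule. *)
      define k where "k = (LEAST k. (1 / 2 :: real) ^ k \<le> d)"
      have "\<exists>k. (1 / 2 :: real) ^ k < d" using d(1) by (intro real_arch_pow_inv) auto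
      then have k: "(1 / 2 :: real) ^ k \<le> d" unfolding k_def by (metis (mono_tags, lifting) LeastI less_imp_le)
      have "k \<noteq> 0" using k d(2) by (metis not_le power_0)
      then obtain j where j: "k = Suc j" using not0_implies_Suc by blast
      then have "d < (1 / 2) ^ j" unfolding k_def by (metis lessI not_le not_less_Least)
      then have d_lt: "d < 2 * (1 / 2) ^ k" by (simp add: j)
      have polar: "a n = rcis (cmod (a n)) (Arg2pi (a n))"
        using Arg2pi_eq[of "a n"] by (simp add: rcis_def cis_conv_exp)
      have t: "0 < (1 / 2 :: real) ^ k" "(1 / 2 :: real) ^ k \<le> 1" by (simp_all add: power_le_one)
      have "1 / 18 \<le> (1 / 2) ^ k / (9 * d)" using d_lt d by (simp add: field_simps)
      also have "\<dots> \<le> defect (a n) (rcis (1 - (1 / 2) ^ k) \<theta>)"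
        unfolding d_def using near k t by (intro defect_in_carleson_box[OF a1(2) polar]) (auto simp: d_def)
      also have "\<dots> \<le> G k \<theta>"
      proof -
        have disc: "cmod (rcis (1 - (1 / 2) ^ k) \<theta>) < 1" using t by simp
        show ?thesis
          using sum_le_suminf[OF summable_defect[OF a disc], of "{n}"] defect_nonneg[OF a1(2) disc]
          by (simp add: G_def power_one_over)
      qed
      finally have "k \<in> S \<theta>" by (simp add: S_def)
      then have "k \<le> Max (S \<theta>)" using fin by simp
      then have "\<tau> \<theta> \<le> (1 / 2) ^ k" unfolding \<tau>_def by (intro power_decreasing) auto
      then show "\<tau> \<theta> \<le> 1 - cmod (a n)" using k by (simp add: d_def)
    qed
  qed simp
qed

end
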